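(* For every integer $k>0$, the automorphism group of $\operatorname{FLim}(\mathcal{KP}(k))$, the Fraïssé limit of the class $\mathcal{KP}(k)$ of finite ordered $k$-polyhedra, is extremely amenable.
   Context: A polyhedron is a pair $(A,S_A)$ with $A$ a countable set and $S_A$ a hereditary family of finite subsets of $A$ ($u\subseteq v\in S_A$ implies $u\in S_A$) with $\bigcup S_A=A$. It is viewed as a structure in the signature with one $i$-ary relation symbol $R_i$ for each $i\geq1$, where $(a_1,\dots,a_i)\in R_i$ iff the $a_j$ are distinct and $\{a_1,\dots,a_i\}\in S_A$. An ordered polyhedron is a polyhedron with a total order $<$ on $A$, as a structure in the expanded signature. $\mathcal{KP}(k)$ is the class of finite ordered polyhedra $(A,S_A)$ all of whose faces $u\in S_A$ satisfy $|u|\leq k$. It is a Fraïssé class; its Fraïssé limit is the unique (up to isomorphism) countable, locally finite, ultrahomogeneous structure whose age (class of finite structures isomorphic to substructures) is $\mathcal{KP}(k)$. A structure is ultrahomogeneous if each isomorphism between finite substructures extends to an automorphism. The automorphism group of a countable structure is a topological group with the topology of pointwise convergence. A topological group $G$ is extremely amenable if for every continuous action of $G$ on a compact space $X$ there is $x\in X$ with $g\cdot x=x$ for all $g\in G$. *)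

theory Defs
  imports "HOL-Analysis.Analysis" "HOL-Algebra.Group_Action"
begin

section \<open>Relational structures\<close>

record ('r, 'a) rstruct = "'a partial_object" +
  rel :: "'r \<Rightarrow> 'a list set"

text \<open>A relational signature is given by a type of symbols and their arities.\<close>

definition relational_structure :: "('r \<Rightarrow> nat) \<Rightarrow> ('r, 'a) rstruct \<Rightarrow> bool" where
  "relational_structure ar M \<longleftrightarrow>
     (\<forall>s. rel M s \<subseteq> {xs. length xs = ar s \<and> set xs \<subseteq> carrier M})"

definition substructure :: "('r, 'a) rstruct \<Rightarrow> ('r, 'a) rstruct \<Rightarrow> bool" where
  "substructure N M \<longleftrightarrow>
     carrier N \<subseteq> carrier M \<and> (\<forall>s. rel N s = rel M s \<inter> {xs. set xs \<subseteq> carrier N})"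

definition isomorphism :: "('r, 'a) rstruct \<Rightarrow> ('r, 'b) rstruct \<Rightarrow> ('a \<Rightarrow> 'b) \<Rightarrow> bool" where
  "isomorphism M N f \<longleftrightarrow>
     bij_betw f (carrier M) (carrier N) \<and>
     (\<forall>s. \<forall>xs \<in> lists (carrier M). xs \<in> rel M s \<longleftrightarrow> map f xs \<in> rel N s)"

text \<open>As in \<^const>\<open>BijGroup\<close>, automorphisms are extensional on the carrier, so that
  each automorphism is represented by exactly one HOL function.\<close>

definition Aut :: "('r, 'a) rstruct \<Rightarrow> ('a \<Rightarrow> 'a) monoid" where
  "Aut M = (BijGroup (carrier M))
     \<lparr>carrier := {f \<in> Bij (carrier M). isomorphism M M f}\<rparr>"

definition ultrahomogeneous :: "('r, 'a) rstruct \<Rightarrow> bool" where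
  "ultrahomogeneous M \<longleftrightarrow>
     (\<forall>N P f. substructure N M \<and> finite (carrier N) \<and>
              substructure P M \<and> finite (carrier P) \<and> isomorphism N P f \<longrightarrow>
        (\<exists>g \<in> carrier (Aut M). \<forall>x \<in> carrier N. g x = f x))"

text \<open>Every finitely generated substructure is finite; this is automatic here, as there are
  no function symbols.\<close>

definition locally_finite :: "('r, 'a) rstruct \<Rightarrow> bool" where
  "locally_finite M \<longleftrightarrow>
     (\<forall>X \<subseteq> carrier M. finite X \<longrightarrow>
        (\<exists>N. substructure N M \<and> finite (carrier N) \<and> X \<subseteq> carrier N))"

text \<open>Classes of finite structures closed under isomorphism are represented by their members
  on finite sets of natural numbers, which is no loss up to isomorphism.\<close>

definition age :: "('r \<Rightarrow> nat) \<Rightarrow> ('r, 'a) rstruct \<Rightarrow> ('r, nat) rstruct set" where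
  "age ar M =
     {N. relational_structure ar N \<and> finite (carrier N) \<and>
         (\<exists>P f. substructure P M \<and> isomorphism N P f)}"

definition fraisse_limit ::
    "('r \<Rightarrow> nat) \<Rightarrow> ('r, nat) rstruct set \<Rightarrow> ('r, 'a) rstruct \<Rightarrow> bool" where
  "fraisse_limit ar K M \<longleftrightarrow>
     relational_structure ar M \<and> countable (carrier M) \<and> locally_finite M \<and>
     ultrahomogeneous M \<and> age ar M = K"


section \<open>Ordered polyhedra\<close>

definition polyhedron :: "'a set \<Rightarrow> 'a set set \<Rightarrow> bool" where
  "polyhedron A S \<longleftrightarrow>
     countable A \<and> (\<forall>u \<in> S. finite u) \<and> (\<forall>v \<in> S. \<forall>u \<subseteq> v. u \<in> S) \<and> \<Union>S = A"

text \<open>\<open>Face i\<close> stands for the symbol \<open>R\<^sub>j\<close> with \<open>j = i + 1\<close>, since only positive arities occur.\<close>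

datatype polysym = Face nat | Less

primrec polysym_arity :: "polysym \<Rightarrow> nat" where
  "polysym_arity (Face i) = Suc i"
| "polysym_arity Less = 2"

definition ordered_polyhedron_struct ::
    "'a set \<Rightarrow> 'a set set \<Rightarrow> ('a \<times> 'a) set \<Rightarrow> (polysym, 'a) rstruct" where
  "ordered_polyhedron_struct A S r =
     \<lparr>carrier = A,
      rel = (\<lambda>s. case s of
               Face i \<Rightarrow> {xs. length xs = Suc i \<and> distinct xs \<and> set xs \<in> S}
             | Less \<Rightarrow> {[x, y] | x y. (x, y) \<in> r})\<rparr>"

definition KP :: "nat \<Rightarrow> (polysym, 'a) rstruct set" where
  "KP k = {ordered_polyhedron_struct A S r | A S r.
     finite A \<and> polyhedron A S \<and> r \<subseteq> A \<times> A \<and> strict_linear_order_on A r \<and>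
     (\<forall>u \<in> S. card u \<le> k)}"


section \<open>Extreme amenability\<close>

definition pointwise_topology :: "('r, 'a) rstruct \<Rightarrow> ('a \<Rightarrow> 'a) topology" where
  "pointwise_topology M =
     subtopology (product_topology (\<lambda>_. discrete_topology (carrier M)) (carrier M))
       (carrier (Aut M))"

definition topological_group :: "('g, 'm) monoid_scheme \<Rightarrow> 'g topology \<Rightarrow> bool" where
  "topological_group G T \<longleftrightarrow>
     group G \<and> topspace T = carrier G \<and>
     continuous_map (prod_topology T T) T (\<lambda>(g, h). g \<otimes>\<^bsub>G\<^esub> h) \<and>
     continuous_map T T (\<lambda>g. inv\<^bsub>G\<^esub> g)"

text \<open>Compact spaces are nonempty and Hausdorff: without these conventions no group,
  respectively no nontrivial group, would be extremely amenable. HOL cannot quantify over types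
  inside a formula, so the type of points of the space is a parameter; with a type
  variable in this place, a theorem covers all compact spaces.\<close>

definition extremely_amenable ::
    "'x itself \<Rightarrow> ('g, 'm) monoid_scheme \<Rightarrow> 'g topology \<Rightarrow> bool" where
  "extremely_amenable _ G T \<longleftrightarrow>
     topological_group G T \<and>
     (\<forall>(X :: 'x topology) \<phi>.
        topspace X \<noteq> {} \<and> compact_space X \<and> Hausdorff_space X \<and>
        group_action G (topspace X) \<phi> \<and>
        continuous_map (prod_topology T X) X (\<lambda>(g, x). \<phi> g x) \<longrightarrow>
        (\<exists>x \<in> topspace X. \<forall>g \<in> carrier G. \<phi> g x = x))"

end

theory Submission
  imports Defs
begin

text \<open>The automorphism group has a fixed point in every compact flow as soon as every finite
  colouring of the copies of a finite substructure \<open>A\<close> is constant on the copies of \<open>A\<close> inside a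
  suitable copy of any given finite substructure \<open>B\<close> (one half of the
  Kechris--Pestov--Todorcevic correspondence).

  This Ramsey property is deduced from the Graham--Rothschild theorem. Let \<open>C\<^sub>n\<close> be the
  \<open>k\<close>-skeleton of the nerve of the nonempty subsets of \<open>{0, \<dots>, n - 1}\<close>. A word \<open>s\<close> of length \<open>n\<close>
  over the faces of \<open>A\<close> sends a vertex \<open>v\<close> to the set of positions \<open>j\<close> with \<open>v \<in> s\<^sub>j\<close>. If every face
  occurs in \<open>s\<close>, then vertices span a face of \<open>A\<close> iff their images have a common element, so this
  is an embedding into \<open>C\<^sub>n\<close>; it respects the orders if the first occurrences of the faces are
  ordered like the faces themselves, that is, if \<open>s\<close> is a rigid surjection. For a copy of \<open>A\<close> in \<open>B\<close>,
  taking traces maps the faces of \<open>B\<close> to those of \<open>A\<close>, and this map is again a rigid surjection.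
  Hence a word over the faces of \<open>B\<close> on which the Graham--Rothschild theorem makes the colouring
  constant yields the required copy of \<open>B\<close>.\<close>



section \<open>The Hales--Jewett theorem\<close>

text \<open>What shapes the construction is the order. A word must carry the order of the vertices,
  and traces along a copy must again give rigid surjections. Both follow from one order on the
  faces, decided by the largest vertex of the symmetric difference, that is, from comparing binary
  codes: it extends inclusion and is respected by order-preserving injections of the vertices. The
  empty face comes first in it and is the single constant letter, so the Graham--Rothschild theorem
  is applied with one constant and with the nonempty faces as parameters. Its proof turns parameters
  into constants one after another, hence it is stated for any positive number of constants; the
  case of constants only is a Hales--Jewett statement. The bound \<open>k\<close> needs no Ramsey
  argument of its own: it is built into the nerve, and a vertex map cannot enlarge a face. By
  ultrahomogeneity every embedding between finite parts of the limit is the restriction of an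
  automorphism, so copies are handled as such restrictions.\<close>

lemma recolour:
  assumes "finite C" "\<And>x. x \<in> W \<Longrightarrow> c x \<in> C"
  shows "\<exists>c'::'w \<Rightarrow> nat. (\<forall>x\<in>W. c' x < card C) \<and> (\<forall>x\<in>W. \<forall>y\<in>W. c' x = c' y \<longrightarrow> c x = c y)"
proof -
  obtain h where h: "bij_betw h C {0..<card C}"
    using ex_bij_betw_finite_nat[OF assms(1)] by blast
  show ?thesis
  proof (intro exI[of _ "h \<circ> c"] conjI ballI impI)
    fix x assume "x \<in> W" then show "(h \<circ> c) x < card C"
      using h assms(2) by (auto simp: bij_betw_def)
  next
    fix x y assume "x \<in> W" "y \<in> W" "(h \<circ> c) x = (h \<circ> c) y"
    then show "c x = c y"
      using h assms(2) by (auto simp: bij_betw_def inj_on_def)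
  qed
qed

definition words :: "nat \<Rightarrow> nat \<Rightarrow> nat list set" where
  "words a n = {xs. set xs \<subseteq> {..<a} \<and> length xs = n}"

lemma finite_words: "finite (words a n)"
  unfolding words_def by (rule finite_lists_length_eq) simp

definition line :: "nat \<Rightarrow> nat \<Rightarrow> nat option list \<Rightarrow> bool" where
  "line a n L \<longleftrightarrow> length L = n \<and> None \<in> set L \<and> set L \<subseteq> insert None (Some ` {..<a})"

text \<open>The letter \<open>t\<close> need not be below \<open>a\<close>: with
  \<open>t = a\<close> a line over \<open>a\<close> letters becomes a word over \<open>Suc a\<close>
  letters, which serves as the focus of lines and later as a word with one parameter.\<close>

definition point :: "nat option list \<Rightarrow> nat \<Rightarrow> nat list" where
  "point L t = map (case_option t id) L"

lemma point_in_words: "line a n L \<Longrightarrow> t < a \<Longrightarrow> point L t \<in> words a n"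
  by (force simp: line_def point_def words_def)

lemma line_mono: "line a n L \<Longrightarrow> a \<le> b \<Longrightarrow> line b n L"
  by (force simp: line_def)

lemma line_append: "line a n L \<Longrightarrow> line a m K \<Longrightarrow> line a (n + m) (L @ K)"
  by (auto simp: line_def)

lemma line_append_word: "line a n L \<Longrightarrow> y \<in> words a m \<Longrightarrow> line a (n + m) (L @ map Some y)"
  by (auto simp: line_def words_def)

lemma point_append: "point (L @ K) t = point L t @ point K t"
  by (simp add: point_def)

lemma point_Some: "point (map Some y) t = y"
  by (induction y) (auto simp: point_def)

lemma words_append: "x \<in> words a n \<Longrightarrow> y \<in> words a m \<Longrightarrow> x @ y \<in> words a (n + m)"
  by (auto simp: words_def)

definition mono_line :: "nat \<Rightarrow> nat \<Rightarrow> (nat list \<Rightarrow> 'c) \<Rightarrow> bool" where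
  "mono_line a n c \<longleftrightarrow> (\<exists>L. line a n L \<and> (\<forall>s<a. \<forall>t<a. c (point L s) = c (point L t)))"

definition HJ :: "nat \<Rightarrow> bool" where
  "HJ a \<longleftrightarrow> (\<forall>r. \<exists>n. \<forall>c. (\<forall>x\<in>words a n. c x < (r::nat)) \<longrightarrow> mono_line a n c)"

text \<open>Product arguments colour a word by a whole function, so arbitrary finite colour sets are
  needed; numbering the set reduces them to numerical colours.\<close>

lemma HJ_finite:
  assumes "HJ a" "finite (C :: 'c set)"
  shows "\<exists>n. \<forall>c. (\<forall>x\<in>words a n. c x \<in> C) \<longrightarrow> mono_line a n c"
proof -
  obtain n where n: "\<And>c. (\<forall>x\<in>words a n. c x < card C) \<Longrightarrow> mono_line a n c"
    using assms(1) unfolding HJ_def by metis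
  show ?thesis
  proof (intro exI[of _ n] allI impI)
    fix c :: "nat list \<Rightarrow> 'c" assume "\<forall>x\<in>words a n. c x \<in> C"
    then obtain c' where c': "\<forall>x\<in>words a n. c' x < card C"
        "\<forall>x\<in>words a n. \<forall>y\<in>words a n. c' x = c' y \<longrightarrow> c x = c y"
      using recolour[OF assms(2), of "words a n" c] by blast
    obtain L where "line a n L" "\<forall>s<a. \<forall>t<a. c' (point L s) = c' (point L t)"
      using n[OF c'(1)] unfolding mono_line_def by blast
    then show "mono_line a n c" unfolding mono_line_def
      using c'(2) point_in_words by meson
  qed
qed

text \<open>The configuration of the colour-focusing argument: lines that are monochromatic up to
  their last points, which coincide. Their distinct colours bound the number \<open>s\<close> of
  lines by the number of colours.\<close>

definition focused :: "nat \<Rightarrow> nat \<Rightarrow> nat \<Rightarrow> (nat list \<Rightarrow> 'c) \<Rightarrow> bool" where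
  "focused a n s c \<longleftrightarrow>
    (\<exists>\<L> f. finite \<L> \<and> card \<L> = s \<and> f \<in> words (Suc a) n \<and>
      (\<forall>L\<in>\<L>. line (Suc a) n L \<and> point L a = f \<and> (\<forall>t<a. c (point L t) = c (point L 0))) \<and>
      inj_on (\<lambda>L. c (point L 0)) \<L>)"

text \<open>If the common last point has the colour of one of the lines, that line becomes monochromatic;
  otherwise there is room for one more line.\<close>

lemma focusing:
  assumes HJ: "HJ a" and "0 < a"
  shows "\<exists>n. \<forall>c. (\<forall>x\<in>words (Suc a) n. c x < (r::nat)) \<longrightarrow>
    mono_line (Suc a) n c \<or> focused a n s c"
proof (induction s)
  case 0
  show ?case
    unfolding focused_def
    by (rule exI[of _ 0], rule allI, rule impI, rule disjI2, rule exI[of _ "{}"], rule exI[of _ "[]"])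
      (auto simp: words_def)
next
  case (Suc s)
  then obtain n2 where n2: "\<And>c. (\<forall>x\<in>words (Suc a) n2. c x < r) \<Longrightarrow>
    mono_line (Suc a) n2 c \<or> focused a n2 s c"
    by blast
  have "finite (PiE (words (Suc a) n2) (\<lambda>_. {..<r}))"
    by (intro finite_PiE finite_words) auto
  \<comment> \<open>A word \<open>x\<close> of length \<open>n1\<close> is coloured by the function
    sending \<open>y\<close> of length \<open>n2\<close> to \<open>c (x @ y)\<close>; hence
    \<open>n2\<close> has to be fixed before \<open>n1\<close>.\<close>
  from HJ_finite[OF HJ this] obtain n1 where n1:
    "\<And>c. (\<forall>x\<in>words a n1. c x \<in> PiE (words (Suc a) n2) (\<lambda>_. {..<r})) \<Longrightarrow>
     mono_line a n1 c"
    by blast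
  show ?case
  proof (intro exI[of _ "n1 + n2"] allI impI)
    fix c :: "nat list \<Rightarrow> nat"
    assume c: "\<forall>x\<in>words (Suc a) (n1 + n2). c x < r"
    have w1: "x \<in> words (Suc a) n1" if "x \<in> words a n1" for x
      using that by (auto simp: words_def)
    have "\<forall>x\<in>words a n1. (\<lambda>y\<in>words (Suc a) n2. c (x @ y)) \<in> PiE (words (Suc a) n2) (\<lambda>_. {..<r})"
      using c w1 words_append by (auto simp: PiE_iff)
    from n1[OF this] obtain K where K: "line a n1 K"
      and Kc: "\<forall>s<a. \<forall>t<a. (\<lambda>y\<in>words (Suc a) n2. c (point K s @ y)) = (\<lambda>y\<in>words (Suc a) n2. c (point K t @ y))"
      unfolding mono_line_def by blast
    have Kc: "c (point K t @ y) = c (point K 0 @ y)" if "t < a" "y \<in> words (Suc a) n2" for t y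
      using Kc[rule_format, OF that(1) \<open>0 < a\<close>] that(2) by (metis restrict_apply')
    have K': "line (Suc a) n1 K" using K line_mono by force
    define c2 where "c2 y = c (point K 0 @ y)" for y
    have "\<forall>y\<in>words (Suc a) n2. c2 y < r"
      unfolding c2_def using c K' point_in_words words_append by (metis zero_less_Suc)
    from n2[OF this] show
      "mono_line (Suc a) (n1 + n2) c \<or> focused a (n1 + n2) (Suc s) c" (is "?mono \<or> ?foc")
    proof
      assume "mono_line (Suc a) n2 c2"
      then obtain L where L: "line (Suc a) n2 L" "\<forall>s<Suc a. \<forall>t<Suc a. c2 (point L s) = c2 (point L t)"
        unfolding mono_line_def by blast
      have "line (Suc a) (n1 + n2) (map Some (point K 0) @ L)"
        using L(1) point_in_words[OF K' zero_less_Suc] by (auto simp: line_def words_def)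
      moreover have "point (map Some (point K 0) @ L) t = point K 0 @ point L t" for t
        by (simp add: point_append point_Some)
      ultimately show ?thesis
        using L(2) unfolding c2_def mono_line_def by metis
    next
      assume "focused a n2 s c2"
      then obtain \<L> f where \<L>: "finite \<L>" "card \<L> = s" and f: "f \<in> words (Suc a) n2"
        and lin: "\<And>L. L \<in> \<L> \<Longrightarrow> line (Suc a) n2 L" and foc: "\<And>L. L \<in> \<L> \<Longrightarrow> point L a = f"
        and mono: "\<And>L t. L \<in> \<L> \<Longrightarrow> t < a \<Longrightarrow> c2 (point L t) = c2 (point L 0)"
        and inj: "inj_on (\<lambda>L. c2 (point L 0)) \<L>"
        unfolding focused_def by blast
      have pw: "point L t \<in> words (Suc a) n2" if "L \<in> \<L>" "t < a" for L t
        using point_in_words[OF lin[OF that(1)]] that(2) by simp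
      show ?thesis
      proof (cases "\<exists>L\<in>\<L>. c2 (point L 0) = c2 f")
        case True
        then obtain L where L: "L \<in> \<L>" "c2 (point L 0) = c2 f" by blast
        have "c2 (point L t) = c2 f" if "t < Suc a" for t
        proof (cases "t = a")
          case True
          then show ?thesis using foc[OF L(1)] by simp
        next
          case False
          then have "t < a" using that by simp
          from mono[OF L(1) this] L(2) show ?thesis by (rule trans)
        qed
        moreover have "line (Suc a) (n1 + n2) (map Some (point K 0) @ L)"
          using lin[OF L(1)] point_in_words[OF K' zero_less_Suc] by (auto simp: line_def words_def)
        moreover have "point (map Some (point K 0) @ L) t = point K 0 @ point L t" for t
          by (simp add: point_append point_Some)
        ultimately have ?mono unfolding c2_def mono_line_def by metis
        then show ?thesis ..
      next
        case False
        \<comment> \<open>Each old line now moves together with \<open>K\<close>, and one further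
          line moves along \<open>K\<close> alone with the old focus \<open>f\<close> kept fixed.
          The colour of the latter is \<open>c2 f\<close>, which is new by the case assumption; at
          the letter \<open>a\<close> all lines end in \<open>point K a @ f\<close>.\<close>
        define \<L>' where "\<L>' = insert (K @ map Some f) ((\<lambda>L. K @ L) ` \<L>)"
        have new: "K @ map Some f \<notin> (\<lambda>L. K @ L) ` \<L>"
          using lin by (force simp: line_def)
        have "card ((\<lambda>L. K @ L) ` \<L>) = s"
          using \<L> by (subst card_image) (auto simp: inj_on_def)
        then have 1: "finite \<L>'" "card \<L>' = Suc s"
          unfolding \<L>'_def using \<L>(1) new by auto
        have 2: "point K a @ f \<in> words (Suc a) (n1 + n2)"
          using point_in_words[OF K', of a] f words_append by simp
        have 3: "line (Suc a) (n1 + n2) L \<and> point L a = point K a @ f \<and>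
             (\<forall>t<a. c (point L t) = c (point L 0))" if "L \<in> \<L>'" for L
          using that unfolding \<L>'_def
        proof
          assume L: "L = K @ map Some f"
          show ?thesis unfolding L point_append point_Some
            using line_append_word[OF K' f] Kc[OF _ f] by blast
        next
          assume "L \<in> (\<lambda>L. K @ L) ` \<L>"
          then obtain L' where L: "L = K @ L'" and L': "L' \<in> \<L>" by blast
          have "c (point K t @ point L' t) = c (point K 0 @ point L' 0)" if "t < a" for t
            using Kc[OF that pw[OF L' that]] mono[OF L' that] by (simp add: c2_def)
          then show ?thesis unfolding L point_append
            using line_append[OF K' lin[OF L']] foc[OF L'] by blast
        qed
        have 4: "inj_on (\<lambda>L. c (point L 0)) \<L>'"
          unfolding \<L>'_def
        proof (rule inj_on_insert[THEN iffD2], intro conjI)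
          show "inj_on (\<lambda>L. c (point L 0)) ((\<lambda>L. K @ L) ` \<L>)"
            using inj by (auto simp: inj_on_def c2_def point_append)
          show "c (point (K @ map Some f) 0) \<notin> (\<lambda>L. c (point L 0)) ` ((\<lambda>L. K @ L) ` \<L> - {K @ map Some f})"
            using False by (force simp: c2_def point_append point_Some)
        qed
        have ?foc unfolding focused_def using 1 2 3 4 by blast
        then show ?thesis ..
      qed
    qed
  qed
qed

theorem Hales_Jewett: "HJ a"
proof (induction a)
  case 0
  show ?case unfolding HJ_def mono_line_def
    by (rule allI, rule exI[of _ 1], rule allI, rule impI, rule exI[of _ "[None]"]) (simp add: line_def)
next
  case (Suc a)
  show ?case
  proof (cases "a = 0")
    case True
    show ?thesis unfolding HJ_def mono_line_def True
      by (rule allI, rule exI[of _ 1], rule allI, rule impI, rule exI[of _ "[None]"]) (simp add: line_def)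
  next
    case False
    show ?thesis unfolding HJ_def
    proof
      fix r
      \<comment> \<open>\<open>Suc r\<close> focused lines would have \<open>Suc r\<close> distinct
        colours out of \<open>r\<close>, so only the monochromatic alternative survives.\<close>
      obtain n where n: "\<And>c. (\<forall>x\<in>words (Suc a) n. c x < (r::nat)) \<Longrightarrow>
        mono_line (Suc a) n c \<or> focused a n (Suc r) c"
        using focusing[OF Suc.IH, of r "Suc r"] False by blast
      have "mono_line (Suc a) n c"
        if c: "\<forall>x\<in>words (Suc a) n. c x < r" for c
        using n[OF c]
      proof
        assume "focused a n (Suc r) c"
        then obtain \<L> where \<L>: "finite \<L>" "card \<L> = Suc r" "\<forall>L\<in>\<L>. line (Suc a) n L"
            "inj_on (\<lambda>L. c (point L 0)) \<L>" unfolding focused_def by blast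
        have "(\<lambda>L. c (point L 0)) ` \<L> \<subseteq> {..<r}"
          using c \<L>(3) point_in_words by (metis image_subsetI lessThan_iff zero_less_Suc)
        then have "card \<L> \<le> card {..<r}"
          using card_inj_on_le[OF \<L>(4)] by blast
        then show ?thesis using \<L>(2) by simp
      qed
      then show "\<exists>n. \<forall>c. (\<forall>x\<in>words (Suc a) n. c x < r) \<longrightarrow> mono_line (Suc a) n c"
        by blast
    qed
  qed
qed


section \<open>The Graham--Rothschild theorem\<close>

text \<open>Parameter words with constants \<open>0, \<dots>, a - 1\<close> and parameters \<open>a, \<dots>, k - 1\<close>, all of which
  occur, in the order of their first occurrences. Substituting such a word \<open>w\<close> for the parameters of
  another one is \<open>plug a w\<close>.\<close>

definition pwords :: "nat \<Rightarrow> nat \<Rightarrow> nat \<Rightarrow> nat list set" where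
  "pwords a k n = {xs. a \<le> k \<and> length xs = n \<and> set xs \<subseteq> {..<k} \<and>
     (\<forall>j. a \<le> j \<longrightarrow> j < k \<longrightarrow> (\<exists>ys zs. xs = ys @ j # zs \<and> set ys \<subseteq> {..<j}))}"

definition plug :: "nat \<Rightarrow> nat list \<Rightarrow> nat list \<Rightarrow> nat list" where
  "plug a w xs = map (\<lambda>x. if x < a then x else w ! (x - a)) xs"

text \<open>For a parameter \<open>j\<close> of a word in \<open>pwords\<close> this is the part
  before its first occurrence; for \<open>j\<close> equal to the upper bound \<open>k\<close> of the
  letters it is the whole word.\<close>

definition prefix_below :: "nat list \<Rightarrow> nat \<Rightarrow> nat list" where
  "prefix_below xs j = takeWhile (\<lambda>x. x < j) xs"

lemma pwordsD:
  assumes "xs \<in> pwords a k n"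
  shows "a \<le> k" "length xs = n" "set xs \<subseteq> {..<k}"
  using assms by (auto simp: pwords_def)

lemma pwords_split:
  assumes "xs \<in> pwords a k n" "a \<le> j" "j < k"
  obtains ys zs where "xs = ys @ j # zs" "set ys \<subseteq> {..<j}" "prefix_below xs j = ys"
proof -
  obtain ys zs where *: "xs = ys @ j # zs" "set ys \<subseteq> {..<j}"
    using assms unfolding pwords_def by blast
  moreover have "prefix_below xs j = ys"
    using * unfolding prefix_below_def by (subst *(1), subst takeWhile_append2) auto
  ultimately show ?thesis using that by blast
qed

lemma pwords_refl: "pwords a a n = words a n"
  by (auto simp: pwords_def words_def)

lemma length_plug [simp]: "length (plug a w xs) = length xs"
  by (simp add: plug_def)

lemma plug_append: "plug a w (xs @ ys) = plug a w xs @ plug a w ys"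
  by (simp add: plug_def)

lemma plug_prefix: "set xs \<subseteq> {..<a + length u} \<Longrightarrow> plug a (u @ v) xs = plug a u xs"
  by (auto simp: plug_def nth_append)

lemma plug_words: "set xs \<subseteq> {..<a + i} \<Longrightarrow> u \<in> words a i \<Longrightarrow> plug a u xs \<in> words a (length xs)"
  by (force simp: plug_def words_def)

lemma plug_plug:
  "set xs \<subseteq> {..<a + length y} \<Longrightarrow> plug a w (plug a y xs) = plug a (plug a w y) xs"
  by (force simp: plug_def)

text \<open>A word with the additional constant \<open>a\<close> is a word with first parameter
  \<open>a\<close>, for which \<open>a\<close> itself is substituted. This links the statements for
  \<open>a\<close> and for \<open>Suc a\<close> constants.\<close>

lemma plug_Suc: "plug (Suc a) v xs = plug a (a # v) xs"
  by (auto simp: plug_def less_Suc_eq not_less nth_Cons')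

text \<open>Raises the parameters by one, so that the letter \<open>a\<close> is free to become a
  new first parameter.\<close>

definition shift :: "nat \<Rightarrow> nat \<Rightarrow> nat" where
  "shift a x = (if x < a then x else Suc x)"

lemma plug_shift: "plug a (s # w) (map (shift a) xs) = plug a w xs"
  by (auto simp: plug_def shift_def)

text \<open>Let the first \<open>j\<close> in \<open>w\<close> stand at position \<open>l\<close>.
  Before its first occurrence in \<open>F\<close>, the parameter \<open>a + l\<close> is preceded
  only by constants, which are below \<open>a \<le> j\<close>, and by parameters whose substitutes
  stand in \<open>w\<close> before position \<open>l\<close> and so are below
  \<open>j\<close>.\<close>

lemma plug_pwords:
  assumes F: "F \<in> pwords a (a + p) n" and w: "w \<in> pwords a k p"
  shows "plug a w F \<in> pwords a k n"
proof -
  have "x < k" if "x \<in> set (plug a w F)" for x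
  proof -
    obtain z where z: "z \<in> set F" "x = (if z < a then z else w ! (z - a))"
      using \<open>x \<in> set (plug a w F)\<close> by (auto simp: plug_def)
    show ?thesis
    proof (cases "z < a")
      case True
      then show ?thesis using z pwordsD(1)[OF w] by simp
    next
      case False
      then have "z - a < length w" using pwordsD(3)[OF F] pwordsD(2)[OF w] z(1) by auto
      then show ?thesis using z False pwordsD(3)[OF w] by (auto dest: nth_mem)
    qed
  qed
  moreover have "\<exists>ys zs. plug a w F = ys @ j # zs \<and> set ys \<subseteq> {..<j}" if j: "a \<le> j" "j < k" for j
  proof -
    obtain ys zs where w': "w = ys @ j # zs" "set ys \<subseteq> {..<j}"
      using pwords_split[OF w j] by metis
    have "length ys < p" using w' pwordsD(2)[OF w] by simp
    then have "a + length ys < a + p" by simp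
    then obtain ys' zs' where F': "F = ys' @ (a + length ys) # zs'" "set ys' \<subseteq> {..<a + length ys}"
      using pwords_split[OF F le_add1] by metis
    have "plug a w F = plug a w ys' @ j # plug a w zs'"
      unfolding F' plug_append by (simp add: plug_def w')
    moreover have "plug a w ys' = plug a ys ys'"
      unfolding w' by (rule plug_prefix) (rule F'(2))
    moreover have "set (plug a ys ys') \<subseteq> {..<j}"
    proof
      fix x assume "x \<in> set (plug a ys ys')"
      then obtain z where z: "z \<in> set ys'" "x = (if z < a then z else ys ! (z - a))"
        by (auto simp: plug_def)
      show "x \<in> {..<j}"
      proof (cases "z < a")
        case True
        then show ?thesis using z j by simp
      next
        case False
        then have "z - a < length ys" using F'(2) z(1) by auto
        then have "ys ! (z - a) \<in> set ys" by (rule nth_mem)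
        then show ?thesis using z False w'(2) by auto
      qed
    qed
    ultimately show ?thesis by auto
  qed
  ultimately show ?thesis
    using pwordsD(1)[OF w] pwordsD(2)[OF F] by (auto simp: pwords_def)
qed

lemma shift_pwords:
  assumes "F \<in> pwords a k n"
  shows "map (shift a) F \<in> pwords (Suc a) (Suc k) n"
proof -
  have "\<exists>ys zs. map (shift a) F = ys @ j # zs \<and> set ys \<subseteq> {..<j}" if j: "Suc a \<le> j" "j < Suc k" for j
  proof -
    obtain i where i: "j = Suc i" "a \<le> i" "i < k" using j by (cases j) auto
    obtain ys zs where "F = ys @ i # zs" "set ys \<subseteq> {..<i}" 
      using pwords_split[OF assms i(2,3)] by metis
    then show ?thesis
      using i by (intro exI[of _ "map (shift a) ys"] exI[of _ "map (shift a) zs"]) (force simp: shift_def)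
  qed
  then show ?thesis
    using pwordsD[OF assms] by (force simp: pwords_def shift_def)
qed

lemma Cons_pwords:
  assumes "E \<in> pwords (Suc a) k n"
  shows "a # E \<in> pwords a k (Suc n)"
proof -
  have "\<exists>ys zs. a # E = ys @ j # zs \<and> set ys \<subseteq> {..<j}" if j: "a \<le> j" "j < k" for j
  proof (cases "j = a")
    case True
    then show ?thesis by (intro exI[of _ "[]"] exI[of _ E]) simp
  next
    case False
    then have "Suc a \<le> j" using j by simp
    then obtain ys zs where "E = ys @ j # zs" "set ys \<subseteq> {..<j}" 
      using pwords_split[OF assms _ j(2)] by metis
    then show ?thesis
      using \<open>Suc a \<le> j\<close> by (intro exI[of _ "a # ys"] exI[of _ zs]) auto
  qed
  then show ?thesis
    using pwordsD[OF assms] by (auto simp: pwords_def)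
qed

lemma Cons_const_pwords:
  assumes "E \<in> pwords a k n" "t < a"
  shows "t # E \<in> pwords a k (Suc n)"
proof -
  have "\<exists>ys zs. t # E = ys @ j # zs \<and> set ys \<subseteq> {..<j}" if j: "a \<le> j" "j < k" for j
  proof -
    obtain ys zs where "E = ys @ j # zs" "set ys \<subseteq> {..<j}" 
      using pwords_split[OF assms(1) j] by metis
    then show ?thesis
      using assms that by (intro exI[of _ "t # ys"] exI[of _ zs]) auto
  qed
  then show ?thesis
    using pwordsD[OF assms(1)] assms(2) by (auto simp: pwords_def)
qed

lemma snoc_pwords:
  assumes "F \<in> pwords a k n"
  shows "F @ [k] \<in> pwords a (Suc k) (Suc n)" and "x < k \<Longrightarrow> F @ [x] \<in> pwords a k (Suc n)"
proof -
  have *: "\<exists>ys zs. F @ [x] = ys @ j # zs \<and> set ys \<subseteq> {..<j}" if j: "a \<le> j" "j < k" for j x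
  proof -
    obtain ys zs where "F = ys @ j # zs" "set ys \<subseteq> {..<j}" 
      using pwords_split[OF assms(1) j] by metis
    then show ?thesis
      by (intro exI[of _ ys] exI[of _ "zs @ [x]"]) auto
  qed
  then show "x < k \<Longrightarrow> F @ [x] \<in> pwords a k (Suc n)"
    using pwordsD[OF assms(1)] by (auto simp: pwords_def)
  have "\<exists>ys zs. F @ [k] = ys @ j # zs \<and> set ys \<subseteq> {..<j}" if "a \<le> j" "j < Suc k" for j
    using that * pwordsD(3)[OF assms(1)] by (cases "j = k") auto
  then show "F @ [k] \<in> pwords a (Suc k) (Suc n)"
    using pwordsD[OF assms(1)] by (auto simp: pwords_def)
qed

lemma plug_point:
  assumes "line a n L"
  shows "plug a (t # u) (point L a) = point L t"
  using assms unfolding line_def plug_def point_def by (force split: option.splits)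

section \<open>Words on whose levels a colouring is constant\<close>

definition level_mono :: "nat \<Rightarrow> nat \<Rightarrow> nat \<Rightarrow> (nat list \<Rightarrow> 'c) \<Rightarrow> bool" where
  "level_mono a m n c \<longleftrightarrow> (\<exists>F\<in>pwords a (a + m) n. \<forall>i\<le>m. \<forall>u\<in>words a i. \<forall>u'\<in>words a i.
     c (plug a u (prefix_below F (a + i))) = c (plug a u' (prefix_below F (a + i))))"

text \<open>The prefixes before the parameters \<open>a + i\<close> have different lengths for
  different levels \<open>i\<close>, so a colouring must be given on all words up to some
  length.\<close>

definition short_words :: "nat \<Rightarrow> nat \<Rightarrow> nat list set" where
  "short_words a n = {xs. set xs \<subseteq> {..<a} \<and> length xs \<le> n}"

lemma length_pre: "length (prefix_below xs j) \<le> length xs"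
  by (simp add: prefix_below_def length_takeWhile_le)

lemma set_pre: "set (prefix_below xs j) \<subseteq> {..<j}"
  by (auto simp: prefix_below_def dest: set_takeWhileD)

lemma plug_pre_short:
  assumes "F \<in> pwords a k n" "u \<in> words a i"
  shows "plug a u (prefix_below F (a + i)) \<in> short_words a n"
  using plug_words[OF set_pre assms(2), of F] length_pre[of F "a + i"] pwordsD(2)[OF assms(1)]
  by (auto simp: words_def short_words_def)

lemma level_mono_recolour:
  assumes ex: "\<And>r::nat. \<exists>n. \<forall>c. (\<forall>x\<in>short_words a n. c x < r) \<longrightarrow> level_mono a m n c"
    and "finite (C :: 'c set)"
  shows "\<exists>n. \<forall>c. (\<forall>x\<in>short_words a n. c x \<in> C) \<longrightarrow> level_mono a m n c"
proof -
  obtain n where n: "\<forall>c. (\<forall>x\<in>short_words a n. c x < card C) \<longrightarrow> level_mono a m n c"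
    using ex by blast
  show ?thesis
  proof (intro exI[of _ n] allI impI)
    fix c :: "nat list \<Rightarrow> 'c" assume "\<forall>x\<in>short_words a n. c x \<in> C"
    then obtain c' where c': "\<forall>x\<in>short_words a n. c' x < card C"
        "\<forall>x\<in>short_words a n. \<forall>y\<in>short_words a n. c' x = c' y \<longrightarrow> c x = c y"
      using recolour[OF assms(2), of "short_words a n" c] by blast
    from n c'(1) have "level_mono a m n c'" by blast
    then show "level_mono a m n c" unfolding level_mono_def
      using c'(2) plug_pre_short by meson
  qed
qed

text \<open>A finite form of the Carlson--Simpson theorem.\<close>

lemma level_Ramsey:
  assumes "0 < a"
  shows "\<exists>n. \<forall>c. (\<forall>x\<in>short_words a n. c x < (r::nat)) \<longrightarrow> level_mono a m n c"
proof (induction m arbitrary: r)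
  case 0
  have "[] \<in> pwords a (a + 0) 0" by (simp add: pwords_def)
  then show ?case unfolding level_mono_def by (intro exI[of _ 0] allI impI bexI[of _ "[]"]) (auto simp: words_def)
next
  case (Suc m)
  \<comment> \<open>The dimension \<open>n1\<close> serves colours that are tuples indexed by the
    levels \<open>0, ..., m\<close>; \<open>n2\<close> comes afterwards, for colours that are
    functions on the words of length \<open>n1\<close>.\<close>
  obtain n1 where n1: "\<And>c. (\<forall>x\<in>words a n1. c x \<in> PiE {..m} (\<lambda>_. {..<r})) \<Longrightarrow> mono_line a n1 c"
    using HJ_finite[OF Hales_Jewett, of "PiE {..m} (\<lambda>_. {..<r})" a] by (metis finite_PiE finite_atMost finite_lessThan)
  have "finite (PiE (words a n1) (\<lambda>_. {..<r}))"
    by (intro finite_PiE finite_words) auto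
  from level_mono_recolour[OF Suc.IH this] obtain n2 where
    n2: "\<And>c. (\<forall>x\<in>short_words a n2. c x \<in> PiE (words a n1) (\<lambda>_. {..<r})) \<Longrightarrow> level_mono a m n2 c"
    by blast
  show ?case
  proof (intro exI[of _ "n1 + n2"] allI impI)
    fix c assume c: "\<forall>x\<in>short_words a (n1 + n2). c x < r"
    have cr: "c (x @ y) < r" if "x \<in> words a n1" "y \<in> short_words a n2" for x y
      using that c by (auto simp: words_def short_words_def)
    then have "\<forall>y\<in>short_words a n2. (\<lambda>x\<in>words a n1. c (x @ y)) \<in> PiE (words a n1) (\<lambda>_. {..<r})"
      by (auto simp: PiE_iff)
    from n2[OF this] obtain F where F: "F \<in> pwords a (a + m) n2" and
      Fc: "\<And>i u u'. i \<le> m \<Longrightarrow> u \<in> words a i \<Longrightarrow> u' \<in> words a i \<Longrightarrow>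
        (\<lambda>x\<in>words a n1. c (x @ plug a u (prefix_below F (a + i)))) =
        (\<lambda>x\<in>words a n1. c (x @ plug a u' (prefix_below F (a + i))))"
      unfolding level_mono_def by blast
    \<comment> \<open>By \<open>Fc\<close> one substitution represents a whole level; the constant 0
      is available because \<open>0 < a\<close>.\<close>
    define z where "z i = plug a (replicate i 0) (prefix_below F (a + i))" for i
    have rep: "replicate i 0 \<in> words a i" for i
      using assms by (auto simp: words_def)
    have Fz: "c (x @ plug a u (prefix_below F (a + i))) = c (x @ z i)"
      if "i \<le> m" "u \<in> words a i" "x \<in> words a n1" for i u x
      using fun_cong[OF Fc[OF that(1,2) rep], of x] that(3) by (simp add: z_def)
    have "\<forall>x\<in>words a n1. (\<lambda>i\<in>{..m}. c (x @ z i)) \<in> PiE {..m} (\<lambda>_. {..<r})"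
      using cr plug_pre_short[OF F rep] unfolding z_def by (auto simp: PiE_iff)
    from n1[OF this] obtain L where L: "line a n1 L" and
      Lc: "\<And>s t. s < a \<Longrightarrow> t < a \<Longrightarrow> (\<lambda>i\<in>{..m}. c (point L s @ z i)) = (\<lambda>i\<in>{..m}. c (point L t @ z i))"
      unfolding mono_line_def by blast
    have Lc: "c (point L s @ z i) = c (point L t @ z i)" if "s < a" "t < a" "i \<le> m" for s t i
      using fun_cong[OF Lc[OF that(1,2)], of i] that(3) by simp
    \<comment> \<open>The moving coordinates of \<open>L\<close> form the new first parameter
      \<open>a\<close>, and the parameters of \<open>F\<close> move up by one. Level
      \<open>Suc i'\<close> of \<open>G\<close> is the block from \<open>L\<close> followed by level
      \<open>i'\<close> of \<open>F\<close>; level 0 admits only the empty substitution.\<close>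
    define G where "G = point L a @ map (shift a) F"
    have sF: "map (shift a) F \<in> pwords (Suc a) (Suc (a + m)) n2"
      by (rule shift_pwords) (rule F)
    have La: "point L a \<in> words (Suc a) n1"
      using L line_mono[OF L, of "Suc a"] point_in_words by auto
    have G: "G \<in> pwords a (a + Suc m) (n1 + n2)"
    proof -
      have "\<exists>ys zs. G = ys @ j # zs \<and> set ys \<subseteq> {..<j}" if "a \<le> j" "j < a + Suc m" for j
      proof (cases "j = a")
        case True
        obtain ys zs where ys: "L = ys @ None # zs" "None \<notin> set ys"
          using L by (meson line_def split_list_first)
        have "set (point ys a) \<subseteq> {..<a}"
          using L ys unfolding line_def point_def by (force split: option.splits)
        moreover have "G = point ys a @ a # point zs a @ map (shift a) F"
          unfolding G_def ys(1) by (simp add: point_def)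
        ultimately show ?thesis using True by blast
      next
        case False
        then have "Suc a \<le> j" "j < Suc (a + m)" using that by auto
        from pwords_split[OF sF this] obtain ys zs where
          "map (shift a) F = ys @ j # zs" "set ys \<subseteq> {..<j}" by metis
        then show ?thesis
          using La that False unfolding G_def
          by (intro exI[of _ "point L a @ ys"] exI[of _ zs]) (auto simp: words_def)
      qed
      then show ?thesis
        using pwordsD[OF sF] La by (auto simp: pwords_def words_def G_def)
    qed
    have "c (plug a u (prefix_below G (a + i))) = c (plug a u' (prefix_below G (a + i)))"
      if "i \<le> Suc m" "u \<in> words a i" "u' \<in> words a i" for i u u'
    proof (cases i)
      case 0
      then show ?thesis using that by (simp add: words_def)
    next
      case (Suc i')
      have preG: "prefix_below G (a + i) = point L a @ map (shift a) (prefix_below F (a + i'))"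
      proof -
        have "prefix_below G (a + i) = point L a @ prefix_below (map (shift a) F) (a + i)"
          unfolding G_def prefix_below_def using La Suc by (intro takeWhile_append2) (auto simp: words_def)
        moreover have "(\<lambda>x. x < a + i) \<circ> shift a = (\<lambda>x. x < a + i')"
          using Suc by (auto simp: shift_def fun_eq_iff)
        ultimately show ?thesis by (simp add: prefix_below_def takeWhile_map)
      qed
      have *: "c (plug a v (prefix_below G (a + i))) = c (point L 0 @ z i')" if v: "v \<in> words a i" for v
      proof -
        obtain t v' where v': "v = t # v'" "t < a" "v' \<in> words a i'"
          using v Suc by (cases v) (auto simp: words_def)
        have "plug a v (prefix_below G (a + i)) = point L t @ plug a v' (prefix_below F (a + i'))"
          unfolding preG v' plug_append plug_shift plug_point[OF L] ..
        then show ?thesis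
          using Fz[OF _ v'(3) point_in_words[OF L v'(2)]] Lc[OF v'(2) assms] Suc \<open>i \<le> Suc m\<close> by simp
      qed
      show ?thesis using *[OF that(2)] *[OF that(3)] by simp
    qed
    then show "level_mono a (Suc m) (n1 + n2) c"
      unfolding level_mono_def using G by blast
  qed
qed

section \<open>The Graham--Rothschild theorem by descent on the number of constants\<close>

definition param_mono :: "nat \<Rightarrow> nat \<Rightarrow> nat \<Rightarrow> nat \<Rightarrow> (nat list \<Rightarrow> 'c) \<Rightarrow> bool" where
  "param_mono a k p n c \<longleftrightarrow> (\<exists>F\<in>pwords a (a + p) n. \<forall>w\<in>pwords a k p. \<forall>w'\<in>pwords a k p.
     c (plug a w F) = c (plug a w' F))"

text \<open>A halfway stage: the colour of a substituted word may still depend on the constants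
  \<open>u\<close> before its first parameter, but on nothing after that.\<close>

definition prefix_mono :: "nat \<Rightarrow> nat \<Rightarrow> nat \<Rightarrow> nat \<Rightarrow> (nat list \<Rightarrow> 'c) \<Rightarrow> bool" where
  "prefix_mono a k p n c \<longleftrightarrow> (\<exists>F\<in>pwords a (a + p) n. \<forall>u v v'. set u \<subseteq> {..<a} \<longrightarrow>
     u @ a # v \<in> pwords a k p \<longrightarrow> u @ a # v' \<in> pwords a k p \<longrightarrow>
     c (plug a (u @ a # v) F) = c (plug a (u @ a # v') F))"

lemma prefix_mono_recolour:
  assumes ex: "\<And>r::nat. \<exists>n. \<forall>c. (\<forall>x\<in>pwords a k n. c x < r) \<longrightarrow> prefix_mono a k p n c"
    and "finite (C :: 'c set)"
  shows "\<exists>n. \<forall>c. (\<forall>x\<in>pwords a k n. c x \<in> C) \<longrightarrow> prefix_mono a k p n c"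
proof -
  obtain n where n: "\<forall>c. (\<forall>x\<in>pwords a k n. c x < card C) \<longrightarrow> prefix_mono a k p n c"
    using ex by blast
  show ?thesis
  proof (intro exI[of _ n] allI impI)
    fix c :: "nat list \<Rightarrow> 'c" assume "\<forall>x\<in>pwords a k n. c x \<in> C"
    then obtain c' where c': "\<forall>x\<in>pwords a k n. c' x < card C"
        "\<forall>x\<in>pwords a k n. \<forall>y\<in>pwords a k n. c' x = c' y \<longrightarrow> c x = c y"
      using recolour[OF assms(2), of "pwords a k n" c] by blast
    from n c'(1) have "prefix_mono a k p n c'" by blast
    then show "prefix_mono a k p n c" unfolding prefix_mono_def
      using c'(2) plug_pwords by meson
  qed
qed

text \<open>After its first occurrence the letter \<open>a\<close> behaves like a constant, so the
  theorem for \<open>Suc a\<close> constants governs the rest of the word. The induction on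
  \<open>p\<close> peels off the first letter: if it is \<open>a\<close>, then \<open>GR\<close>
  applies; if it is a constant, the induction hypothesis does.\<close>

lemma prefix_Ramsey:
  assumes GR: "\<And>p r::nat. \<exists>n. \<forall>c. (\<forall>x\<in>pwords (Suc a) k n. c x < r) \<longrightarrow> param_mono (Suc a) k p n c"
  shows "\<exists>n. \<forall>c. (\<forall>x\<in>pwords a k n. c x < (r::nat)) \<longrightarrow> prefix_mono a k p n c"
proof (induction p arbitrary: r)
  case 0
  have "[] \<in> pwords a (a + 0) 0" by (simp add: pwords_def)
  then show ?case
    unfolding prefix_mono_def by (intro exI[of _ 0] allI impI bexI[of _ "[]"]) (auto simp: pwords_def)
next
  case (Suc p)
  have "finite (PiE {..<a} (\<lambda>_. {..<r}))" by (intro finite_PiE) auto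
  from prefix_mono_recolour[OF Suc.IH this] obtain q where
    q: "\<And>c. (\<forall>x\<in>pwords a k q. c x \<in> PiE {..<a} (\<lambda>_. {..<r})) \<Longrightarrow> prefix_mono a k p q c"
    by blast
  obtain n where n: "\<And>c. (\<forall>x\<in>pwords (Suc a) k n. c x < r) \<Longrightarrow> param_mono (Suc a) k q n c"
    using GR by blast
  show ?case
  proof (intro exI[of _ "Suc n"] allI impI)
    fix c assume c: "\<forall>x\<in>pwords a k (Suc n). c x < r"
    then have "\<forall>x\<in>pwords (Suc a) k n. c (a # x) < r" using Cons_pwords by blast
    from n[OF this] obtain E where E: "E \<in> pwords (Suc a) (Suc a + q) n" and
      Ec: "\<And>w w'. w \<in> pwords (Suc a) k q \<Longrightarrow> w' \<in> pwords (Suc a) k q \<Longrightarrow>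
        c (a # plug (Suc a) w E) = c (a # plug (Suc a) w' E)"
      unfolding param_mono_def by blast
    have aE: "a # E \<in> pwords a (a + Suc q) (Suc n)"
      using Cons_pwords[OF E] by simp
    have tE: "t # plug a (t # y) E \<in> pwords a k (Suc n)" if "t < a" "y \<in> pwords a k q" for t y
    proof -
      have "t # plug a (t # y) E = plug a (t # y) (a # E)" by (simp add: plug_def)
      then show ?thesis using plug_pwords[OF aE Cons_const_pwords[OF that(2,1)]] by simp
    qed
    have "\<forall>y\<in>pwords a k q. (\<lambda>t\<in>{..<a}. c (t # plug a (t # y) E)) \<in> PiE {..<a} (\<lambda>_. {..<r})"
      using c tE by (auto simp: PiE_iff)
    from q[OF this] obtain G where G: "G \<in> pwords a (a + p) q" and
      Gc: "\<And>u v v'. set u \<subseteq> {..<a} \<Longrightarrow> u @ a # v \<in> pwords a k p \<Longrightarrow> u @ a # v' \<in> pwords a k p \<Longrightarrow>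
       (\<lambda>t\<in>{..<a}. c (t # plug a (t # plug a (u @ a # v) G) E)) =
       (\<lambda>t\<in>{..<a}. c (t # plug a (t # plug a (u @ a # v') G) E))"
      unfolding prefix_mono_def by blast
    \<comment> \<open>\<open>E\<close> settles substitutions with first letter \<open>a\<close>, and
      \<open>G\<close> those with first letter \<open>t < a\<close>. The shift keeps
      \<open>a\<close> free in \<open>G\<close>, so by \<open>plugH\<close> the first letter
      \<open>s\<close> fills the initial position and the letter \<open>a\<close> of
      \<open>E\<close>, while \<open>G\<close> receives the rest.\<close>
    define H where "H = a # plug (Suc a) (map (shift a) G) E"
    have sG: "map (shift a) G \<in> pwords (Suc a) (Suc a + p) q"
      using shift_pwords[OF G] by simp
    have H: "H \<in> pwords a (a + Suc p) (Suc n)"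
      unfolding H_def using Cons_pwords[OF plug_pwords[OF E sG]] by simp
    have setE: "set E \<subseteq> {..<a + length (a # map (shift a) G)}"
      using pwordsD[OF E] pwordsD[OF G] by auto
    have plugH: "plug a (s # w) H = s # plug a (s # plug a w G) E" for s w
    proof -
      have "plug a (s # w) H = s # plug a (s # w) (plug a (a # map (shift a) G) E)"
        by (simp add: H_def plug_Suc) (simp add: plug_def)
      also have "\<dots> = s # plug a (plug a (s # w) (a # map (shift a) G)) E"
        by (simp only: plug_plug[OF setE])
      also have "plug a (s # w) (a # map (shift a) G) = s # plug a (s # w) (map (shift a) G)"
        by (simp add: plug_def)
      finally show ?thesis by (simp add: plug_shift)
    qed
    have "c (plug a (u @ a # v) H) = c (plug a (u @ a # v') H)"
      if u: "set u \<subseteq> {..<a}" and v: "u @ a # v \<in> pwords a k (Suc p)" and v': "u @ a # v' \<in> pwords a k (Suc p)"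
      for u v v'
    proof (cases u)
      case Nil
      have *: "plug a v G \<in> pwords (Suc a) k q" if "a # v \<in> pwords a k (Suc p)" for v
      proof -
        have "v \<in> pwords (Suc a) k p"
        proof -
          have "\<exists>ys zs. v = ys @ j # zs \<and> set ys \<subseteq> {..<j}" if j: "Suc a \<le> j" "j < k" for j
          proof -
            obtain ys zs where "a # v = ys @ j # zs" "set ys \<subseteq> {..<j}"
              using pwords_split[OF \<open>a # v \<in> pwords a k (Suc p)\<close> Suc_leD[OF j(1)] j(2)] by metis
            then show ?thesis using j by (cases ys) auto
          qed
          then show ?thesis using pwordsD[OF that] by (auto simp: pwords_def)
        qed
        from plug_pwords[OF sG this] show ?thesis
          by (simp add: plug_Suc plug_shift)
      qed
      have "c (a # plug (Suc a) (plug a v G) E) = c (a # plug (Suc a) (plug a v' G) E)"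
        using v v' Nil by (intro Ec *) auto
      then show ?thesis by (simp add: Nil plugH plug_Suc)
    next
      case (Cons t u')
      have drop: "w \<in> pwords a k p" if "t # w \<in> pwords a k (Suc p)" for w
      proof -
        have "\<exists>ys zs. w = ys @ j # zs \<and> set ys \<subseteq> {..<j}" if j: "a \<le> j" "j < k" for j
        proof -
          obtain ys zs where "t # w = ys @ j # zs" "set ys \<subseteq> {..<j}"
            using pwords_split[OF \<open>t # w \<in> pwords a k (Suc p)\<close> j] by metis
          then show ?thesis using j u Cons by (cases ys) auto
        qed
        then show ?thesis using pwordsD[OF that] by (auto simp: pwords_def)
      qed
      have "t < a" using u Cons by simp
      have "(\<lambda>t\<in>{..<a}. c (t # plug a (t # plug a (u' @ a # v) G) E)) =
       (\<lambda>t\<in>{..<a}. c (t # plug a (t # plug a (u' @ a # v') G) E))"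
        using u v v' Cons by (intro Gc drop) auto
      from fun_cong[OF this, of t] \<open>t < a\<close>
      show ?thesis by (simp add: Cons plugH)
    qed
    then show "prefix_mono a k (Suc p) (Suc n) c"
      unfolding prefix_mono_def using H by blast
  qed
qed

text \<open>The word has a new parameter at each position in \<open>I\<close> and the constant 0
  elsewhere. Substituting it for the parameters of another word discards the levels with index
  outside \<open>I\<close>.\<close>

lemma skip_word:
  assumes "0 < a"
  shows "\<exists>J\<in>pwords a (a + card (I \<inter> {..<n})) n. \<forall>j<card (I \<inter> {..<n}). length (prefix_below J (a + j)) \<in> I"
proof (induction n)
  case 0
  then show ?case by (auto simp: pwords_def)
next
  case (Suc n)
  define q where "q = card (I \<inter> {..<n})"
  obtain J where J: "J \<in> pwords a (a + q) n" "\<And>j. j < q \<Longrightarrow> length (prefix_below J (a + j)) \<in> I"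
    using Suc unfolding q_def by blast
  have old: "length (prefix_below (J @ [x]) (a + j)) \<in> I" if j: "j < q" for j x
  proof -
    obtain ys zs where "J = ys @ (a + j) # zs"
      using pwords_split[OF J(1) le_add1 add_strict_left_mono[OF j]] by metis
    then have "prefix_below (J @ [x]) (a + j) = prefix_below J (a + j)"
      unfolding prefix_below_def by (intro takeWhile_append1[of "a + j"]) auto
    then show ?thesis using J(2)[OF j] by simp
  qed
  show ?case
  proof (cases "n \<in> I")
    case True
    then have "I \<inter> {..<Suc n} = insert n (I \<inter> {..<n})" by auto
    then have c: "card (I \<inter> {..<Suc n}) = Suc q" by (simp add: q_def)
    have "prefix_below (J @ [a + q]) (a + q) = J"
      using pwordsD(3)[OF J(1)] unfolding prefix_below_def by (subst takeWhile_append2) auto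
    then have "length (prefix_below (J @ [a + q]) (a + q)) = n" using pwordsD(2)[OF J(1)] by simp
    then have "\<forall>j<Suc q. length (prefix_below (J @ [a + q]) (a + j)) \<in> I"
      using old True by (auto simp: less_Suc_eq)
    then show ?thesis unfolding c using snoc_pwords(1)[OF J(1)] by auto
  next
    case False
    then have "I \<inter> {..<Suc n} = I \<inter> {..<n}" by (auto simp: less_Suc_eq)
    then have c: "card (I \<inter> {..<Suc n}) = q" by (simp add: q_def)
    show ?thesis unfolding c using snoc_pwords(2)[OF J(1), of 0] old assms by auto
  qed
qed

lemma pigeonhole_fibre:
  assumes "\<forall>i<p * r + 1. e i < (r::nat)"
  shows "\<exists>I y. I \<subseteq> {..<p * r + 1} \<and> card I = p \<and> (\<forall>i\<in>I. e i = y)"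
proof -
  have "\<exists>y<r. p \<le> card {i\<in>{..<p * r + 1}. e i = y}"
  proof (rule ccontr)
    assume neg: "\<not> ?thesis"
    have "{..<p * r + 1} = (\<Union>y<r. {i\<in>{..<p * r + 1}. e i = y})" using assms by auto
    then have "card {..<p * r + 1} \<le> (\<Sum>y<r. card {i\<in>{..<p * r + 1}. e i = y})"
      by (metis card_UN_le finite_lessThan)
    also have "\<dots> \<le> (\<Sum>y<r. p)" using neg by (intro sum_mono) (auto simp: not_le less_imp_le)
    finally show False by simp
  qed
  then obtain y where "p \<le> card {i\<in>{..<p * r + 1}. e i = y}" by blast
  then obtain I where "I \<subseteq> {i\<in>{..<p * r + 1}. e i = y}" "card I = p"
    by (meson obtain_subset_with_card_n)
  then show ?thesis by blast
qed

text \<open>The induction runs downwards from \<open>a = k\<close>, where the coloured words have no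
  parameters. Below that, the colour is first made to depend only on the part before the first
  parameter. This part is a word over the constants, so constancy on levels leaves a dependence on
  the level alone, and the pigeonhole principle selects \<open>p\<close> levels of one
  colour.\<close>

theorem Graham_Rothschild:
  assumes "a \<le> k" "0 < a"
  shows "\<exists>n. \<forall>c. (\<forall>x\<in>pwords a k n. c x < (r::nat)) \<longrightarrow> param_mono a k p n c"
  using assms
proof (induction a arbitrary: p r rule: inc_induct)
  case base
  obtain n where n: "\<And>c. (\<forall>x\<in>short_words k n. c x < Suc r) \<Longrightarrow> level_mono k p n c"
    using level_Ramsey[OF base, of "Suc r" p] by blast
  show ?case
  proof (intro exI[of _ n] allI impI)
    fix c assume c: "\<forall>x\<in>pwords k k n. c x < r"
    \<comment> \<open>Words of other lengths get the dummy colour 0, for which \<open>Suc r\<close>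
      leaves room even if \<open>r = 0\<close>. At the top level \<open>p\<close> the prefix is
      \<open>F\<close> itself.\<close>
    define c' where "c' x = (if length x = n then c x else 0)" for x
    have "\<forall>x\<in>short_words k n. c' x < Suc r"
      using c by (auto simp: c'_def short_words_def pwords_refl words_def less_Suc_eq)
    from n[OF this] obtain F where F: "F \<in> pwords k (k + p) n" and
      Fc: "\<forall>u\<in>words k p. \<forall>u'\<in>words k p. c' (plug k u (prefix_below F (k + p))) = c' (plug k u' (prefix_below F (k + p)))"
      unfolding level_mono_def by blast
    have "prefix_below F (k + p) = F"
      using pwordsD(3)[OF F] by (auto simp: prefix_below_def takeWhile_eq_all_conv)
    moreover have "c' (plug k u F) = c (plug k u F)" for u
      using pwordsD(2)[OF F] by (simp add: c'_def)
    ultimately have "\<forall>u\<in>words k p. \<forall>u'\<in>words k p. c (plug k u F) = c (plug k u' F)"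
      using Fc by metis
    then show "param_mono k k p n c"
      unfolding param_mono_def pwords_refl using F by blast
  qed
next
  case (step a)
  \<comment> \<open>The levels \<open>0, ..., m\<close> are \<open>p * Suc r + 1\<close> in number,
    and \<open>c'\<close> below has \<open>Suc r\<close> colours, so \<open>p\<close> levels share a
    colour.\<close>
  define m where "m = p * Suc r"
  obtain n2 where n2: "\<And>c. (\<forall>x\<in>short_words a n2. c x < Suc r) \<Longrightarrow> level_mono a m n2 c"
    using level_Ramsey[OF step.prems, of "Suc r" m] by blast
  have "\<And>p r::nat. \<exists>n. \<forall>c. (\<forall>x\<in>pwords (Suc a) k n. c x < r) \<longrightarrow> param_mono (Suc a) k p n c"
    using step.IH by simp
  \<comment> \<open>One place more than \<open>n2\<close>, for the letter that ends the topmost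
    level.\<close>
  from prefix_Ramsey[OF this] obtain n where
    n: "\<And>c. (\<forall>x\<in>pwords a k n. c x < r) \<Longrightarrow> prefix_mono a k (Suc n2) n c"
    by blast
  show ?case
  proof (intro exI[of _ n] allI impI)
    fix c assume c: "\<forall>x\<in>pwords a k n. c x < r"
    from n[OF this] obtain G where G: "G \<in> pwords a (a + Suc n2) n" and
      Gc: "\<And>u v v'. set u \<subseteq> {..<a} \<Longrightarrow> u @ a # v \<in> pwords a k (Suc n2) \<Longrightarrow>
        u @ a # v' \<in> pwords a k (Suc n2) \<Longrightarrow> c (plug a (u @ a # v) G) = c (plug a (u @ a # v') G)"
      unfolding prefix_mono_def by blast
    \<comment> \<open>For \<open>u\<close> made of constants, \<open>Gc\<close> makes the choice of
      the continuation \<open>v\<close> immaterial; a \<open>u\<close> without continuation gets the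
      dummy colour 0.\<close>
    define c' where "c' u = (if \<exists>v. u @ a # v \<in> pwords a k (Suc n2)
      then c (plug a (u @ a # (SOME v. u @ a # v \<in> pwords a k (Suc n2))) G) else 0)" for u
    have c'eq: "c (plug a (u @ a # v) G) = c' u" if "set u \<subseteq> {..<a}" "u @ a # v \<in> pwords a k (Suc n2)" for u v
      using that Gc[OF that someI[of "\<lambda>v. u @ a # v \<in> pwords a k (Suc n2)"]] by (auto simp: c'_def)
    have c'r: "c' u < Suc r" for u
    proof (cases "\<exists>v. u @ a # v \<in> pwords a k (Suc n2)")
      case True
      from someI_ex[OF this] c plug_pwords[OF G] show ?thesis using True by (auto simp: c'_def less_Suc_eq)
    qed (simp add: c'_def)
    from n2[of c'] c'r obtain F where F: "F \<in> pwords a (a + m) n2" and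
      Fc: "\<And>i u u'. i \<le> m \<Longrightarrow> u \<in> words a i \<Longrightarrow> u' \<in> words a i \<Longrightarrow>
        c' (plug a u (prefix_below F (a + i))) = c' (plug a u' (prefix_below F (a + i)))"
      unfolding level_mono_def by blast
    define e where "e i = c' (plug a (replicate i 0) (prefix_below F (a + i)))" for i
    obtain I y where I: "I \<subseteq> {..<Suc m}" "card I = p" "\<And>i. i \<in> I \<Longrightarrow> e i = y"
      using pigeonhole_fibre[of p "Suc r" e] c'r unfolding m_def e_def by auto
    have rep: "replicate i 0 \<in> words a i" for i
      using step.prems by (auto simp: words_def)
    have Fy: "c' (plug a u (prefix_below F (a + i))) = y" if "i \<in> I" "u \<in> words a i" for i u
    proof -
      have "i \<le> m" using I(1) that(1) by auto
      from Fc[OF this that(2) rep] I(3)[OF that(1)] show ?thesis by (simp add: e_def)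
    qed
    have "I \<inter> {..<Suc m} = I" using I(1) by auto
    then obtain J where J: "J \<in> pwords a (a + p) (Suc m)" "\<And>j. j < p \<Longrightarrow> length (prefix_below J (a + j)) \<in> I"
      using skip_word[OF step.prems, of I "Suc m"] I(2) by auto
    \<comment> \<open>The appended parameter \<open>a + m\<close> ensures that every level
      \<open>0, ..., m\<close> of \<open>F\<close> is followed by the parameter with its own
      index.\<close>
    define F' where "F' = F @ [a + m]"
    have F': "F' \<in> pwords a (a + Suc m) (Suc n2)"
      unfolding F'_def using snoc_pwords(1)[OF F] by simp
    have F'split: "\<exists>zs. F' = prefix_below F (a + i) @ (a + i) # zs" if i: "i < Suc m" for i
    proof (cases "i = m")
      case True
      have "prefix_below F (a + m) = F"
        using pwordsD(3)[OF F] by (auto simp: prefix_below_def takeWhile_eq_all_conv)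
      then show ?thesis by (auto simp: F'_def True)
    next
      case False
      then obtain ys zs where "F = ys @ (a + i) # zs" "prefix_below F (a + i) = ys"
        using pwords_split[OF F le_add1, of i] i by (metis add_strict_left_mono less_antisym)
      then show ?thesis by (auto simp: F'_def)
    qed
    \<comment> \<open>For \<open>w\<close> in \<open>pwords a k p\<close> the first \<open>a\<close>
      of \<open>plug a w J\<close> stands at a position \<open>i\<close> in \<open>I\<close>, so the
      first \<open>a\<close> of \<open>plug a w H\<close> comes right after a word of level
      \<open>i\<close>, whose \<open>c'\<close>-colour is \<open>y\<close>.\<close>
    define H where "H = plug a J F'"
    have H: "H \<in> pwords a (a + p) (Suc n2)" unfolding H_def by (rule plug_pwords[OF F' J(1)])
    have Hc: "c (plug a (plug a w H) G) = y" if w: "w \<in> pwords a k p" for w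
    proof -
      obtain ys zs where ys: "w = ys @ a # zs" "set ys \<subseteq> {..<a}"
        using pwords_split[OF w order_refl] step.hyps by (metis Suc_le_eq)
      define j where "j = length ys"
      have j: "j < p" using pwordsD(2)[OF w] ys by (simp add: j_def)
      obtain ys1 zs1 where J1: "J = ys1 @ (a + j) # zs1" "set ys1 \<subseteq> {..<a + j}" "prefix_below J (a + j) = ys1"
        using pwords_split[OF J(1) le_add1 add_strict_left_mono[OF j]] by metis
      define i where "i = length ys1"
      have iI: "i \<in> I" using J(2)[OF j] J1(3) by (simp add: i_def)
      define u where "u = plug a ys ys1"
      have u: "u \<in> words a i"
        unfolding u_def i_def using ys(2) by (intro plug_words[OF J1(2)]) (auto simp: words_def j_def)
      have wJ: "plug a w J = u @ a # plug a w zs1"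
      proof -
        have "plug a w ys1 = u" unfolding ys u_def by (rule plug_prefix) (use J1(2) j_def in simp)
        moreover have "plug a w [a + j] = [a]" by (simp add: plug_def ys j_def)
        moreover have "plug a w J = plug a w ys1 @ plug a w [a + j] @ plug a w zs1"
          by (simp add: J1(1) flip: plug_append)
        ultimately show ?thesis by simp
      qed
      obtain zs2 where F2: "F' = prefix_below F (a + i) @ (a + i) # zs2"
        using F'split iI I(1) by blast
      have "plug a (u @ a # v) [a + i] = [a]" for v
        using u by (simp add: plug_def words_def nth_append)
      then have hit: "plug a (plug a w J) [a + i] = [a]"
        unfolding wJ .
      have wH: "plug a w H = plug a u (prefix_below F (a + i)) @ a # plug a (plug a w J) zs2"
      proof -
        have "plug a w H = plug a (plug a w J) F'"
          unfolding H_def by (rule plug_plug) (use pwordsD[OF F'] pwordsD[OF J(1)] in auto)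
        also have "\<dots> = plug a (plug a w J) (prefix_below F (a + i)) @ plug a (plug a w J) ([a + i] @ zs2)"
          by (subst F2) (simp add: plug_append)
        also have "plug a (plug a w J) (prefix_below F (a + i)) = plug a u (prefix_below F (a + i))"
          unfolding wJ by (rule plug_prefix) (use set_pre u in \<open>auto simp: words_def\<close>)
        also have "plug a (plug a w J) ([a + i] @ zs2) = a # plug a (plug a w J) zs2"
          unfolding plug_append hit by simp
        finally show ?thesis .
      qed
      have "plug a w H \<in> pwords a k (Suc n2)" by (rule plug_pwords[OF H w])
      moreover have "set (plug a u (prefix_below F (a + i))) \<subseteq> {..<a}"
        using plug_words[OF set_pre u] by (auto simp: words_def)
      ultimately show ?thesis
        using c'eq[of "plug a u (prefix_below F (a + i))"] Fy[OF iI u] unfolding wH by simp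
    qed
    define T where "T = plug a H G"
    have "T \<in> pwords a (a + p) n" unfolding T_def by (rule plug_pwords[OF G H])
    moreover have "c (plug a w T) = y" if "w \<in> pwords a k p" for w
    proof -
      have "plug a w T = plug a (plug a w H) G"
        unfolding T_def by (rule plug_plug) (use pwordsD[OF G] pwordsD[OF H] in auto)
      then show ?thesis using Hc[OF that] by simp
    qed
    ultimately show "param_mono a k p n c"
      unfolding param_mono_def by auto
  qed
qed


section \<open>Ordered simplicial complexes\<close>

lemma set_encode_less:
  assumes fin: "finite X" "finite Y" and b: "b \<in> Y" "b \<notin> X" and below: "\<And>x. x \<in> X - Y \<Longrightarrow> x < b"
  shows "set_encode X < set_encode Y"
proof -
  have split: "set_encode Z = sum ((^) (2::nat)) (Z \<inter> Z') + sum ((^) (2::nat)) (Z - Z')" if "finite Z" for Z Z'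
    unfolding set_encode_def by (rule sum.Int_Diff[OF that])
  have "sum ((^) (2::nat)) (X - Y) \<le> sum ((^) (2::nat)) {..<b}"
    using below by (intro sum_mono2) auto
  also have "\<dots> < (2::nat) ^ b"
    by (simp add: lessThan_atLeast0 sum_power2)
  also have "\<dots> \<le> sum ((^) (2::nat)) (Y - X)"
    using fin b by (intro member_le_sum) auto
  finally show ?thesis
    using split[OF fin(1), of Y] split[OF fin(2), of X] by (simp add: Int_commute)
qed

lemma set_encode_less_iff:
  assumes fin: "finite X" "finite Y"
  shows "set_encode X < set_encode Y \<longleftrightarrow> (\<exists>b\<in>Y - X. \<forall>x\<in>X - Y. x < b)"
proof
  assume less: "set_encode X < set_encode Y"
  let ?D = "(X - Y) \<union> (Y - X)"
  have D: "finite ?D" "?D \<noteq> {}" using fin less by auto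
  have max: "x \<le> Max ?D" if "x \<in> ?D" for x using Max_ge[OF D(1) that] .
  have "Max ?D \<in> Y - X"
  proof (rule ccontr)
    assume "Max ?D \<notin> Y - X"
    then have m: "Max ?D \<in> X" "Max ?D \<notin> Y" using Max_in[OF D] by auto
    have "set_encode Y < set_encode X"
      using m(1) m(2) max by (intro set_encode_less[OF fin(2,1) m]) (metis DiffD1 DiffD2 UnI2 le_neq_implies_less)
    then show False using less by simp
  qed
  moreover have "x < Max ?D" if "x \<in> X - Y" for x
    using max[of x] that calculation by (metis DiffD2 DiffD1 UnI1 le_neq_implies_less)
  ultimately show "\<exists>b\<in>Y - X. \<forall>x\<in>X - Y. x < b" by blast
next
  assume "\<exists>b\<in>Y - X. \<forall>x\<in>X - Y. x < b"
  then show "set_encode X < set_encode Y" using set_encode_less[OF fin] by blast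
qed

lemma set_encode_le_subset: "finite Y \<Longrightarrow> X \<subseteq> Y \<Longrightarrow> set_encode X \<le> set_encode Y"
  unfolding set_encode_def by (intro sum_mono2) auto

lemma set_encode_less_power: "X \<subseteq> {..<n} \<Longrightarrow> set_encode X < 2 ^ n"
  using set_encode_less[of X "{n}" n] finite_subset[of X "{..<n}"] by force

lemma set_encode_ge_power: "finite X \<Longrightarrow> x \<in> X \<Longrightarrow> 2 ^ x \<le> set_encode X"
  using set_encode_le_subset[of X "{x}"] by simp

text \<open>A comparison of codes is decided by the largest element of the symmetric difference, and
  an injection that keeps the order takes differences to differences and keeps their largest
  elements.\<close>

lemma set_encode_image_mono:
  fixes f f' :: "'b \<Rightarrow> nat"
  assumes "finite Z" and inj: "inj_on f Z" "inj_on f' Z"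
    and mono: "\<And>x y. x \<in> Z \<Longrightarrow> y \<in> Z \<Longrightarrow> f x < f y \<Longrightarrow> f' x < f' y"
    and sub: "u \<subseteq> Z" "v \<subseteq> Z"
    and less: "set_encode (f ` u) < set_encode (f ` v)"
  shows "set_encode (f' ` u) < set_encode (f' ` v)"
proof -
  have fin: "finite u" "finite v" using sub assms(1) finite_subset by auto
  have diff: "h ` v - h ` u = h ` (v - u)" "h ` u - h ` v = h ` (u - v)" if "inj_on h Z" for h :: "'b \<Rightarrow> nat"
    using inj_on_image_set_diff[OF that] sub by (metis Diff_subset order_trans)+
  have fins: "finite (h ` u)" "finite (h ` v)" for h :: "'b \<Rightarrow> nat" using fin by auto
  obtain b where "b \<in> v - u" "\<forall>x\<in>u - v. f x < f b"
    using less unfolding set_encode_less_iff[OF fins] diff[OF inj(1)] by auto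
  then have "f' b \<in> f' ` (v - u)" "\<forall>x\<in>f' ` (u - v). x < f' b" using mono sub by blast+
  then show ?thesis
    unfolding set_encode_less_iff[OF fins] diff[OF inj(2)] by (intro bexI)
qed

definition order_rank :: "('b \<Rightarrow> 'b \<Rightarrow> bool) \<Rightarrow> 'b set \<Rightarrow> 'b \<Rightarrow> nat" where
  "order_rank R S x = card {y \<in> S. R y x}"

definition strict_total_on :: "'b set \<Rightarrow> ('b \<Rightarrow> 'b \<Rightarrow> bool) \<Rightarrow> bool" where
  "strict_total_on S R \<longleftrightarrow> (\<forall>x\<in>S. \<not> R x x) \<and>
     (\<forall>x\<in>S. \<forall>y\<in>S. \<forall>z\<in>S. R x y \<longrightarrow> R y z \<longrightarrow> R x z) \<and>
     (\<forall>x\<in>S. \<forall>y\<in>S. x \<noteq> y \<longrightarrow> R x y \<or> R y x)"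

lemma order_rank_less_iff:
  assumes S: "finite S" "strict_total_on S R" and xy: "x \<in> S" "y \<in> S"
  shows "order_rank R S x < order_rank R S y \<longleftrightarrow> R x y"
proof -
  have *: "order_rank R S x < order_rank R S y" if "x \<in> S" "y \<in> S" "R x y" for x y
  proof -
    have "{z \<in> S. R z x} \<subseteq> {z \<in> S. R z y}" using S(2) that unfolding strict_total_on_def by blast
    moreover have "x \<in> {z \<in> S. R z y}" "x \<notin> {z \<in> S. R z x}"
      using that S(2) by (auto simp: strict_total_on_def)
    ultimately have "{z \<in> S. R z x} \<subset> {z \<in> S. R z y}" by blast
    then show ?thesis unfolding order_rank_def using S(1) by (intro psubset_card_mono) auto
  qed
  have "x \<noteq> y \<Longrightarrow> R x y \<or> R y x" "\<not> R x x"
    using S(2) xy by (auto simp: strict_total_on_def)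
  then show ?thesis
    using *[OF xy] *[OF xy(2,1)] by (metis less_asym less_irrefl)
qed

lemma order_rank_bij:
  assumes S: "finite S" "strict_total_on S R"
  shows "bij_betw (order_rank R S) S {..<card S}"
proof -
  have "inj_on (order_rank R S) S"
  proof (rule inj_onI, rule ccontr)
    fix x y assume xy: "x \<in> S" "y \<in> S" "order_rank R S x = order_rank R S y" "x \<noteq> y"
    then have "R x y \<or> R y x" using S(2) by (auto simp: strict_total_on_def)
    then show False
      using order_rank_less_iff[OF S xy(1,2)] order_rank_less_iff[OF S xy(2,1)] xy(3) by auto
  qed
  moreover have "order_rank R S x < card S" if "x \<in> S" for x
  proof -
    have "{y \<in> S. R y x} \<subseteq> S" "x \<notin> {y \<in> S. R y x}"
      using S(2) that by (auto simp: strict_total_on_def)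
    then have "{y \<in> S. R y x} \<subset> S" using that by blast
    then show ?thesis unfolding order_rank_def by (rule psubset_card_mono[OF S(1)])
  qed
  then have "order_rank R S ` S \<subseteq> {..<card S}" by auto
  ultimately show ?thesis
    by (simp add: bij_betw_def card_image card_subset_eq)
qed

lemma map_in_lists_bij:
  assumes "bij_betw h A B" "xs \<in> lists B"
  shows "\<exists>ys\<in>lists A. map h ys = xs"
proof -
  have "lists B = map h ` lists A"
    using assms(1) lists_image[of h A] by (simp add: bij_betw_def)
  then show ?thesis using assms(2) by auto
qed

text \<open>The symbols have positive arity and never see the empty set, which is therefore added by
  hand; it becomes the constant letter.\<close>

definition face :: "(polysym, 'a) rstruct \<Rightarrow> 'a set \<Rightarrow> bool" where
  "face M u \<longleftrightarrow> u = {} \<or> (\<exists>xs i. xs \<in> rel M (Face i) \<and> set xs = u)"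

definition lt :: "(polysym, 'a) rstruct \<Rightarrow> 'a \<Rightarrow> 'a \<Rightarrow> bool" where
  "lt M x y \<longleftrightarrow> [x, y] \<in> rel M Less"

definition restr :: "('r, 'a) rstruct \<Rightarrow> 'a set \<Rightarrow> ('r, 'a) rstruct" where
  "restr M B = \<lparr>carrier = B, rel = (\<lambda>s. rel M s \<inter> {xs. set xs \<subseteq> B})\<rparr>"

lemma substructure_restr: "B \<subseteq> carrier M \<Longrightarrow> substructure (restr M B) M"
  by (simp add: substructure_def restr_def)

section \<open>Faces, order and embeddings in the limit\<close>

locale polyhedral_limit =
  fixes k :: nat and M :: "(polysym, 'a) rstruct"
  assumes k_pos: "0 < k" and limit: "fraisse_limit polysym_arity (KP k) M"
begin

lemma rel_struct: "xs \<in> rel M s \<Longrightarrow> length xs = polysym_arity s \<and> set xs \<subseteq> carrier M"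
  using limit unfolding fraisse_limit_def relational_structure_def by blast

text \<open>The age consists of structures on natural numbers, so the structure induced on
  \<open>B\<close> is copied to an initial segment of them, recognized there as a member of
  \<open>KP k\<close>, and its polyhedron is carried back along \<open>h\<close>.\<close>

lemma local_polyhedron:
  assumes B: "B \<subseteq> carrier M" "finite B"
  obtains S r where "polyhedron B S" "strict_linear_order_on B r" "\<And>u. u \<in> S \<Longrightarrow> card u \<le> k"
    "\<And>xs i. set xs \<subseteq> B \<Longrightarrow> xs \<in> rel M (Face i) \<longleftrightarrow> length xs = Suc i \<and> distinct xs \<and> set xs \<in> S"
    "\<And>x y. x \<in> B \<Longrightarrow> y \<in> B \<Longrightarrow> lt M x y \<longleftrightarrow> (x, y) \<in> r"
proof -
  obtain h where h: "bij_betw h {..<card B} B"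
    using bij_betw_from_nat_into_finite[OF B(2)] by blast
  define N where "N = \<lparr>carrier = {..<card B}, rel = (\<lambda>s. {xs. set xs \<subseteq> {..<card B} \<and> map h xs \<in> rel M s})\<rparr>"
  have hB: "h ` {..<card B} = B" using h by (simp add: bij_betw_def)
  have "isomorphism N (restr M B) h"
    unfolding isomorphism_def N_def restr_def using h hB by auto
  moreover have "relational_structure polysym_arity N"
    unfolding relational_structure_def N_def using rel_struct by fastforce
  ultimately have "N \<in> age polysym_arity M"
    unfolding age_def using substructure_restr[OF B(1)] by (auto simp: N_def)
  then have "N \<in> KP k" using limit by (simp add: fraisse_limit_def)
  then obtain A S r where N: "N = ordered_polyhedron_struct A S r" and A: "polyhedron A S" "r \<subseteq> A \<times> A"
      "strict_linear_order_on A r" "\<And>u. u \<in> S \<Longrightarrow> card u \<le> k"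
    unfolding KP_def by blast
  have "A = {..<card B}" using arg_cong[OF N, of carrier] by (simp add: N_def ordered_polyhedron_struct_def)
  then have hA: "bij_betw h A B" using h by simp
  then have inj: "inj_on h A" and im: "h ` A = B" by (auto simp: bij_betw_def)
  have relN: "map h xs \<in> rel M s \<longleftrightarrow> xs \<in> rel (ordered_polyhedron_struct A S r) s" if "set xs \<subseteq> A" for xs s
  proof -
    have "xs \<in> rel N s \<longleftrightarrow> map h xs \<in> rel M s"
      using that \<open>A = _\<close> by (simp add: N_def)
    then show ?thesis unfolding N by simp
  qed
  have SA: "u \<subseteq> A" if "u \<in> S" for u using that A(1) by (auto simp: polyhedron_def)
  have inS: "h ` u \<in> (`) h ` S \<longleftrightarrow> u \<in> S" if "u \<subseteq> A" for u
    using SA that inj by (metis (no_types, lifting) image_iff inj_on_image_eq_iff)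
  have fin: "finite u" if "u \<in> S" for u using that A(1) by (auto simp: polyhedron_def)
  show ?thesis
  proof (rule that[of "(`) h ` S" "{(h x, h y) | x y. (x, y) \<in> r}"])
    have "\<And>u v. v \<in> (`) h ` S \<Longrightarrow> u \<subseteq> v \<Longrightarrow> u \<in> (`) h ` S"
    proof -
      fix u v assume "v \<in> (`) h ` S" "u \<subseteq> v"
      then obtain v' where v': "v' \<in> S" "u \<subseteq> h ` v'" by blast
      then obtain u' where "u' \<subseteq> v'" "u = h ` u'" by (meson subset_image_iff)
      then show "u \<in> (`) h ` S" using v' A(1) unfolding polyhedron_def by blast
    qed
    then show "polyhedron B ((`) h ` S)"
      unfolding polyhedron_def using fin B(2) im A(1)[unfolded polyhedron_def] 
      by (auto simp: countable_finite)
    show "card u \<le> k" if "u \<in> (`) h ` S" for u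
    proof -
      obtain v where v: "v \<in> S" "u = h ` v" using \<open>u \<in> (`) h ` S\<close> by blast
      then show ?thesis using card_image_le[OF fin[OF v(1)], of h] A(4)[OF v(1)] by simp
    qed
    show "strict_linear_order_on B {(h x, h y) | x y. (x, y) \<in> r}"
    proof -
      have tr: "trans r" and irr: "irrefl r" and tot: "total_on A r" 
        using A(3) by (auto simp: strict_linear_order_on_def)
      have "trans {(h x, h y) | x y. (x, y) \<in> r}"
        using tr A(2) inj unfolding trans_def inj_on_def by blast
      moreover have "irrefl {(h x, h y) | x y. (x, y) \<in> r}"
        using irr A(2) inj unfolding irrefl_def inj_on_def by blast
      moreover have "total_on B {(h x, h y) | x y. (x, y) \<in> r}"
      proof (rule total_onI)
        fix x y assume "x \<in> B" "y \<in> B" "x \<noteq> y"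
        then obtain x' y' where xy: "x' \<in> A" "y' \<in> A" "x = h x'" "y = h y'" using im by blast
        then have "(x', y') \<in> r \<or> (y', x') \<in> r"
          using tot \<open>x \<noteq> y\<close> by (auto simp: total_on_def)
        then show "(x, y) \<in> {(h x, h y) | x y. (x, y) \<in> r} \<or> (y, x) \<in> {(h x, h y) | x y. (x, y) \<in> r}"
          using xy by blast
      qed
      ultimately show ?thesis by (simp add: strict_linear_order_on_def)
    qed
    show "xs \<in> rel M (Face i) \<longleftrightarrow> length xs = Suc i \<and> distinct xs \<and> set xs \<in> (`) h ` S"
      if xs: "set xs \<subseteq> B" for xs i
    proof -
      have "xs \<in> lists B" using xs by auto
      from map_in_lists_bij[OF hA this]
      obtain ys where ys: "set ys \<subseteq> A" "xs = map h ys" by auto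
      have "inj_on h (set ys)" using inj ys(1) inj_on_subset by blast
      then show ?thesis
        using inS[OF ys(1)] relN[OF ys(1), of "Face i"] unfolding ys(2)
        by (simp add: ordered_polyhedron_struct_def distinct_map)
    qed
    show "lt M x y \<longleftrightarrow> (x, y) \<in> {(h x, h y) | x y. (x, y) \<in> r}" if "x \<in> B" "y \<in> B" for x y
    proof -
      obtain x' y' where xy: "x' \<in> A" "y' \<in> A" "x = h x'" "y = h y'" using \<open>x \<in> B\<close> \<open>y \<in> B\<close> im by blast
      have "lt M x y \<longleftrightarrow> (x', y') \<in> r"
        using relN[of "[x', y']" Less] xy by (simp add: lt_def ordered_polyhedron_struct_def)
      also have "\<dots> \<longleftrightarrow> (x, y) \<in> {(h x, h y) | x y. (x, y) \<in> r}"
        using xy A(2) inj unfolding inj_on_def by blast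
      finally show ?thesis .
    qed
  qed
qed

lemma face_subset: "face M u \<Longrightarrow> u \<subseteq> carrier M"
  unfolding face_def using rel_struct by blast

lemma face_finite: "face M u \<Longrightarrow> finite u"
  unfolding face_def by auto

lemma face_iff_local:
  assumes S: "\<And>xs i. set xs \<subseteq> B \<Longrightarrow> xs \<in> rel M (Face i) \<longleftrightarrow> length xs = Suc i \<and> distinct xs \<and> set xs \<in> S"
    and u: "u \<subseteq> B" "finite u" "u \<noteq> {}"
  shows "face M u \<longleftrightarrow> u \<in> S"
proof
  assume "face M u"
  then show "u \<in> S" using S u by (auto simp: face_def)
next
  assume "u \<in> S"
  obtain xs where xs: "set xs = u" "distinct xs" using finite_distinct_list[OF u(2)] by blast
  then have "xs \<in> rel M (Face (length xs - 1))"
    using S[of xs "length xs - 1"] u \<open>u \<in> S\<close> by (cases xs) auto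
  then show "face M u" using xs by (auto simp: face_def)
qed

lemma face_hereditary:
  assumes "face M v" "u \<subseteq> v"
  shows "face M u"
proof (cases "u = {}")
  case False
  obtain S r where S: "polyhedron v S"
    "\<And>xs i. set xs \<subseteq> v \<Longrightarrow> xs \<in> rel M (Face i) \<longleftrightarrow> length xs = Suc i \<and> distinct xs \<and> set xs \<in> S"
    using local_polyhedron[OF face_subset face_finite, OF assms(1,1)] by metis
  have fin: "finite u" "finite v" using face_finite[OF assms(1)] assms(2) finite_subset by auto
  have "v \<in> S" using face_iff_local[OF S(2) order_refl fin(2)] assms False by auto
  then have "u \<in> S" using S(1) assms(2) by (auto simp: polyhedron_def)
  then show ?thesis using face_iff_local[OF S(2) assms(2) fin(1) False] by simp
qed (simp add: face_def)

lemma face_card: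
  assumes "face M u"
  shows "card u \<le> k"
proof (cases "u = {}")
  case False
  obtain S r where S: "\<And>u. u \<in> S \<Longrightarrow> card u \<le> k"
    "\<And>xs i. set xs \<subseteq> u \<Longrightarrow> xs \<in> rel M (Face i) \<longleftrightarrow> length xs = Suc i \<and> distinct xs \<and> set xs \<in> S"
    using local_polyhedron[OF face_subset face_finite, OF assms(1,1)] by metis
  then show ?thesis using face_iff_local[OF S(2) order_refl face_finite[OF assms] False] assms by blast
qed simp

lemma face_singleton:
  assumes "x \<in> carrier M"
  shows "face M {x}"
proof -
  obtain S r where S: "polyhedron {x} S"
    "\<And>xs i. set xs \<subseteq> {x} \<Longrightarrow> xs \<in> rel M (Face i) \<longleftrightarrow> length xs = Suc i \<and> distinct xs \<and> set xs \<in> S"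
    using local_polyhedron[of "{x}"] assms by (metis empty_subsetI finite.emptyI finite_insert insert_subset)
  have "{x} \<in> S" using S(1) unfolding polyhedron_def
    by (metis (no_types, lifting) Sup_insert Union_empty empty_not_insert insert_absorb Union_iff insertI1 subset_singletonD Union_upper)
  then show ?thesis using face_iff_local[OF S(2)] by simp
qed

lemma rel_Face_iff: "xs \<in> rel M (Face i) \<longleftrightarrow> length xs = Suc i \<and> distinct xs \<and> face M (set xs)"
proof (cases "set xs \<subseteq> carrier M")
  case True
  obtain S r where S: 
    "\<And>ys i. set ys \<subseteq> set xs \<Longrightarrow> ys \<in> rel M (Face i) \<longleftrightarrow> length ys = Suc i \<and> distinct ys \<and> set ys \<in> S"
    using local_polyhedron[OF True] by (metis List.finite_set)
  show ?thesis
  proof (cases "xs = []")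
    case True
    then show ?thesis using rel_struct[of "[]" "Face i"] by auto
  next
    case False
    then show ?thesis using face_iff_local[OF S order_refl] S[OF order_refl, of i] by simp
  qed
next
  case False
  then show ?thesis using rel_struct face_subset by blast
qed

text \<open>Each axiom of a strict linear order speaks of at most three points and can be read off
  from the substructure on them.\<close>

lemma lt_order:
  assumes "x \<in> carrier M" "y \<in> carrier M" "z \<in> carrier M"
  shows "\<not> lt M x x" "lt M x y \<Longrightarrow> lt M y z \<Longrightarrow> lt M x z" "x \<noteq> y \<Longrightarrow> lt M x y \<or> lt M y x"
proof -
  have "{x, y, z} \<subseteq> carrier M" "finite {x, y, z}" using assms by auto
  from local_polyhedron[OF this] obtain r where r: "strict_linear_order_on {x, y, z} r"
    and l: "\<And>u v. u \<in> {x, y, z} \<Longrightarrow> v \<in> {x, y, z} \<Longrightarrow> lt M u v \<longleftrightarrow> (u, v) \<in> r" by metis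
  have lt: "lt M x x \<longleftrightarrow> (x, x) \<in> r" "lt M x y \<longleftrightarrow> (x, y) \<in> r" "lt M y x \<longleftrightarrow> (y, x) \<in> r"
    "lt M y z \<longleftrightarrow> (y, z) \<in> r" "lt M x z \<longleftrightarrow> (x, z) \<in> r" by (rule l; simp)+
  show "\<not> lt M x x" using r unfolding lt by (auto simp: strict_linear_order_on_def irrefl_def)
  show "lt M x y \<Longrightarrow> lt M y z \<Longrightarrow> lt M x z" using r unfolding lt strict_linear_order_on_def trans_def by blast
  show "x \<noteq> y \<Longrightarrow> lt M x y \<or> lt M y x" using r unfolding lt strict_linear_order_on_def total_on_def by blast
qed

lemma Aut_bij: "g \<in> carrier (Aut M) \<Longrightarrow> bij_betw g (carrier M) (carrier M)"
  by (simp add: Aut_def Bij_def)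

lemma Aut_face:
  assumes g: "g \<in> carrier (Aut M)" and u: "u \<subseteq> carrier M"
  shows "face M (g ` u) \<longleftrightarrow> face M u"
proof -
  have iso: "xs \<in> rel M s \<longleftrightarrow> map g xs \<in> rel M s" if "set xs \<subseteq> carrier M" for xs s
    using g that by (auto simp: Aut_def isomorphism_def)
  have inj: "inj_on g (carrier M)" and im: "g ` carrier M = carrier M"
    using Aut_bij[OF g] by (auto simp: bij_betw_def)
  show ?thesis
  proof
    assume "face M u"
    then show "face M (g ` u)" unfolding face_def using iso u by (metis image_empty set_map)
  next
    assume f: "face M (g ` u)"
    show "face M u"
    proof (cases "u = {}")
      case False
      then obtain xs i where xs: "xs \<in> rel M (Face i)" "set xs = g ` u" using f by (auto simp: face_def)
      then have "xs \<in> lists (carrier M)" using rel_struct by blast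
      from map_in_lists_bij[OF Aut_bij[OF g] this]
      obtain ys where ys: "set ys \<subseteq> carrier M" "xs = map g ys" by auto
      then have "g ` set ys = g ` u" using xs by simp
      then have "set ys = u" using ys(1) u inj by (meson inj_on_image_eq_iff)
      moreover have "ys \<in> rel M (Face i)" using iso ys xs by auto
      ultimately show ?thesis by (auto simp: face_def)
    qed (simp add: face_def)
  qed
qed

lemma Aut_lt:
  assumes g: "g \<in> carrier (Aut M)" and "x \<in> carrier M" "y \<in> carrier M"
  shows "lt M (g x) (g y) \<longleftrightarrow> lt M x y"
proof -
  have "[x, y] \<in> rel M s \<longleftrightarrow> map g [x, y] \<in> rel M s" for s
    using assms by (auto simp: Aut_def isomorphism_def)
  then show ?thesis by (simp add: lt_def)
qed

text \<open>Totality of the order turns monotonicity into injectivity and reflection of the order.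
  Faces and order determine all relations, so \<open>e\<close> is an isomorphism onto its image, and
  ultrahomogeneity extends it.\<close>

lemma extend_embedding:
  assumes B: "B \<subseteq> carrier M" "finite B" and e: "e ` B \<subseteq> carrier M"
    and fc: "\<And>u. u \<subseteq> B \<Longrightarrow> face M (e ` u) \<longleftrightarrow> face M u"
    and mono: "\<And>x y. x \<in> B \<Longrightarrow> y \<in> B \<Longrightarrow> lt M x y \<Longrightarrow> lt M (e x) (e y)"
  obtains h where "h \<in> carrier (Aut M)" "\<And>x. x \<in> B \<Longrightarrow> h x = e x"
proof -
  have c: "x \<in> carrier M" "e x \<in> carrier M" if "x \<in> B" for x using B e that by auto
  have lt: "lt M (e x) (e y) \<longleftrightarrow> lt M x y" if "x \<in> B" "y \<in> B" for x y
    using mono that lt_order c by metis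
  have inj: "inj_on e B"
    using mono lt_order c unfolding inj_on_def by metis
  have "isomorphism (restr M B) (restr M (e ` B)) e"
  proof -
    have "xs \<in> rel M s \<longleftrightarrow> map e xs \<in> rel M s" if xs: "set xs \<subseteq> B" for xs s
    proof (cases s)
      case (Face i)
      have "distinct (map e xs) \<longleftrightarrow> distinct xs"
        using inj xs by (simp add: distinct_map inj_on_subset)
      then show ?thesis using fc[OF xs] by (simp add: Face rel_Face_iff)
    next
      case Less
      show ?thesis
      proof (cases "length xs = 2")
        case True
        then obtain x y where "xs = [x, y]" by (auto simp: length_Suc_conv numeral_2_eq_2)
        then show ?thesis using lt[of x y] \<open>set xs \<subseteq> B\<close> by (simp add: Less lt_def)
      next
        case False
        then show ?thesis using rel_struct[of xs s] rel_struct[of "map e xs" s] Less by auto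
      qed
    qed
    then show ?thesis using inj by (auto simp: isomorphism_def restr_def bij_betw_def)
  qed
  moreover have "substructure (restr M B) M" "substructure (restr M (e ` B)) M"
    using B e by (auto intro: substructure_restr)
  moreover have "ultrahomogeneous M" using limit by (simp add: fraisse_limit_def)
  moreover have car: "carrier (restr M C) = C" for C by (simp add: restr_def)
  ultimately obtain h where "h \<in> carrier (Aut M)" "\<forall>x\<in>carrier (restr M B). h x = e x"
    unfolding ultrahomogeneous_def using B(2) by (metis car finite_imageI)
  then show ?thesis using that by (simp add: car)
qed

text \<open>The \<open>k\<close>-skeleton of the nerve of the nonempty subsets of \<open>{..<n}\<close>, a subset being
  represented by its binary code.\<close>

lemma embed_nerve:
  obtains \<rho> where "\<rho> ` {1..<2 ^ n} \<subseteq> carrier M"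
    "\<And>u. u \<subseteq> {1..<2 ^ n} \<Longrightarrow> face M (\<rho> ` u) \<longleftrightarrow> u = {} \<or> card u \<le> k \<and> (\<exists>b. \<forall>x\<in>u. b \<in> set_decode x)"
    "\<And>x y. x \<in> {1..<2 ^ n} \<Longrightarrow> y \<in> {1..<2 ^ n} \<Longrightarrow> y < x \<Longrightarrow> lt M (\<rho> x) (\<rho> y)"
proof -
  define A where "A = {1..<2 ^ n :: nat}"
  define S where "S = {u. u \<subseteq> A \<and> (u = {} \<or> card u \<le> k \<and> (\<exists>b. \<forall>x\<in>u. b \<in> set_decode x))}"
  \<comment> \<open>Reversed: a vertex whose singleton occurs early in a word receives a high bit,
    so larger codes must come first in the order.\<close>
  define r where "r = {(x, y). x \<in> A \<and> y \<in> A \<and> y < x}"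
  have SA: "u \<subseteq> A" if "u \<in> S" for u using that by (simp add: S_def)
  \<comment> \<open>A positive number has a binary digit 1, which makes its singleton a face; this
    is why the vertices start at 1.\<close>
  have "{x} \<in> S" if "x \<in> A" for x
  proof -
    have "set_decode x \<noteq> {}"
      using that set_decode_inverse[of x] by (auto simp: A_def simp del: set_decode_inverse)
    then show ?thesis using that k_pos by (auto simp: S_def)
  qed
  then have "\<Union>S = A" using SA by blast
  moreover have "u \<in> S" if "v \<in> S" "u \<subseteq> v" for u v
  proof -
    have "finite v" using that(1) SA finite_subset[of v A] by (simp add: A_def)
    then have "card u \<le> card v" using card_mono that(2) by blast
    show ?thesis
    proof (cases "u = {}")
      case False
      then have v: "v \<noteq> {}" using that(2) by blast
      then have "card v \<le> k" and "\<exists>b. \<forall>x\<in>v. b \<in> set_decode x" using that(1) by (simp_all add: S_def)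
      then have "card u \<le> k" "\<exists>b. \<forall>x\<in>u. b \<in> set_decode x"
        using \<open>card u \<le> card v\<close> that(2) by (simp, blast)
      then show ?thesis using SA[OF that(1)] that(2) by (simp add: S_def)
    qed (simp add: S_def)
  qed
  moreover have "finite u" if "u \<in> S" for u
    using SA[OF that] finite_subset[of u A] by (simp add: A_def)
  ultimately have "polyhedron A S"
    unfolding polyhedron_def by (simp add: A_def)
  moreover have "strict_linear_order_on A r"
    by (auto simp: strict_linear_order_on_def r_def trans_def irrefl_def total_on_def)
  moreover have "card u \<le> k" if "u \<in> S" for u using that by (auto simp: S_def)
  ultimately have "ordered_polyhedron_struct A S r \<in> KP k"
    unfolding KP_def by (intro CollectI exI[of _ A] exI[of _ S] exI[of _ r]) (auto simp: A_def r_def)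
  then have "ordered_polyhedron_struct A S r \<in> age polysym_arity M"
    using limit by (simp add: fraisse_limit_def)
  then obtain P \<rho> where P: "substructure P M" "isomorphism (ordered_polyhedron_struct A S r) P \<rho>"
    by (auto simp: age_def)
  have bij: "bij_betw \<rho> A (carrier P)"
    using P(2) by (simp add: isomorphism_def ordered_polyhedron_struct_def)
  then have inj: "inj_on \<rho> A" and im: "\<rho> ` A = carrier P" by (auto simp: bij_betw_def)
  have sub: "carrier P \<subseteq> carrier M" using P(1) by (simp add: substructure_def)
  have rel: "xs \<in> rel (ordered_polyhedron_struct A S r) s \<longleftrightarrow> map \<rho> xs \<in> rel M s" if "set xs \<subseteq> A" for xs s
  proof -
    have "xs \<in> lists A" using that by auto
    then have "xs \<in> rel (ordered_polyhedron_struct A S r) s \<longleftrightarrow> map \<rho> xs \<in> rel P s"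
      using P(2) by (simp add: isomorphism_def ordered_polyhedron_struct_def)
    also have "\<dots> \<longleftrightarrow> map \<rho> xs \<in> rel M s"
    proof -
      have "set (map \<rho> xs) \<subseteq> carrier P" using that im by auto
      then show ?thesis using P(1) unfolding substructure_def by blast
    qed
    finally show ?thesis .
  qed
  have "face M (\<rho> ` u) \<longleftrightarrow> u \<in> S" if u: "u \<subseteq> A" for u
  proof (cases "u = {}")
    case True
    then show ?thesis by (simp add: face_def S_def)
  next
    case False
    obtain xs where xs: "set xs = u" "distinct xs"
      using finite_distinct_list[of u] u finite_subset[of u A] by (auto simp: A_def)
    then have len: "length xs = Suc (length xs - 1)" using False by (cases xs) auto
    have "distinct (map \<rho> xs)" using xs u inj by (auto simp: distinct_map intro: inj_on_subset)
    then have "face M (\<rho> ` u) \<longleftrightarrow> map \<rho> xs \<in> rel M (Face (length xs - 1))"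
      using len xs by (simp add: rel_Face_iff)
    also have "\<dots> \<longleftrightarrow> u \<in> S"
      using rel[of xs "Face (length xs - 1)"] xs u len by (simp add: ordered_polyhedron_struct_def)
    finally show ?thesis .
  qed
  moreover have "lt M (\<rho> x) (\<rho> y)" if "x \<in> A" "y \<in> A" "y < x" for x y
    using rel[of "[x, y]" Less] that by (simp add: lt_def ordered_polyhedron_struct_def r_def)
  ultimately show ?thesis
    using that[of \<rho>] im sub unfolding A_def[symmetric] by (simp add: S_def)
qed

section \<open>Words over the faces as vertex maps into the nerve\<close>

definition rk :: "'a set \<Rightarrow> 'a \<Rightarrow> nat" where
  "rk B = order_rank (lt M) B"

text \<open>The colexicographic order of faces as an order of numbers: the vertex of largest rank in
  the symmetric difference decides.\<close>

definition code :: "'a set \<Rightarrow> 'a set \<Rightarrow> nat" where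
  "code B u = set_encode (rk B ` u)"

definition faces_in :: "'a set \<Rightarrow> 'a set set" where
  "faces_in B = {u. u \<subseteq> B \<and> face M u}"

text \<open>The empty face gets number 0 and thereby becomes the only constant of
  \<open>pwords 1\<close>.\<close>

definition idx :: "'a set \<Rightarrow> 'a set \<Rightarrow> nat" where
  "idx B = order_rank (\<lambda>u v. code B u < code B v) (faces_in B)"

definition dec :: "'a set \<Rightarrow> nat \<Rightarrow> 'a set" where
  "dec B = inv_into (faces_in B) (idx B)"

text \<open>Positions are counted from the end of the word, so that an early occurrence is a high bit.\<close>

definition bits :: "'a set \<Rightarrow> nat list \<Rightarrow> 'a \<Rightarrow> nat set" where
  "bits B w v = {b. b < length w \<and> v \<in> dec B (w ! (length w - Suc b))}"

definition vertex :: "'a set \<Rightarrow> nat list \<Rightarrow> 'a \<Rightarrow> nat" where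
  "vertex B w v = set_encode (bits B w v)"

lemma faces_in_finite: "finite B \<Longrightarrow> finite (faces_in B)"
  unfolding faces_in_def by auto

lemma empty_faces_in: "{} \<in> faces_in B"
  by (simp add: faces_in_def face_def)

lemma strict_total_lt: "B \<subseteq> carrier M \<Longrightarrow> strict_total_on B (lt M)"
  unfolding strict_total_on_def by (intro conjI ballI impI; rule lt_order; (assumption | (erule (1) subsetD)))

lemma rk_less_iff:
  "B \<subseteq> carrier M \<Longrightarrow> finite B \<Longrightarrow> x \<in> B \<Longrightarrow> y \<in> B \<Longrightarrow> rk B x < rk B y \<longleftrightarrow> lt M x y"
  unfolding rk_def by (intro order_rank_less_iff strict_total_lt)

lemma rk_inj: "B \<subseteq> carrier M \<Longrightarrow> finite B \<Longrightarrow> inj_on (rk B) B"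
  unfolding rk_def using order_rank_bij[OF _ strict_total_lt] by (auto simp: bij_betw_def)

lemma code_inj:
  assumes "B \<subseteq> carrier M" "finite B" "u \<subseteq> B" "v \<subseteq> B" "code B u = code B v"
  shows "u = v"
proof -
  have "finite u" "finite v" using finite_subset[OF _ assms(2)] assms(3,4) by auto
  then have "rk B ` u = rk B ` v" using assms(5) by (simp add: code_def set_encode_eq)
  then show ?thesis using inj_on_image_eq_iff[OF rk_inj[OF assms(1,2)] assms(3,4)] by simp
qed

lemma strict_total_code:
  assumes "B \<subseteq> carrier M" "finite B"
  shows "strict_total_on (faces_in B) (\<lambda>u v. code B u < code B v)"
proof -
  have "code B u < code B v \<or> code B v < code B u" if "u \<in> faces_in B" "v \<in> faces_in B" "u \<noteq> v" for u v
    using code_inj[OF assms, of u v] that by (auto simp: faces_in_def neq_iff[symmetric])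
  then show ?thesis unfolding strict_total_on_def by simp
qed

lemma idx_less_iff:
  assumes "B \<subseteq> carrier M" "finite B" "u \<in> faces_in B" "v \<in> faces_in B"
  shows "idx B u < idx B v \<longleftrightarrow> code B u < code B v"
  unfolding idx_def
  by (rule order_rank_less_iff[OF faces_in_finite strict_total_code]) (use assms in auto)

lemma idx_bij:
  assumes "B \<subseteq> carrier M" "finite B"
  shows "bij_betw (idx B) (faces_in B) {..<card (faces_in B)}"
  unfolding idx_def
  by (rule order_rank_bij[OF faces_in_finite strict_total_code]) (use assms in auto)

lemma dec_idx: "B \<subseteq> carrier M \<Longrightarrow> finite B \<Longrightarrow> u \<in> faces_in B \<Longrightarrow> dec B (idx B u) = u"
  unfolding dec_def using idx_bij by (auto simp: bij_betw_def)

lemma idx_lt_card: "B \<subseteq> carrier M \<Longrightarrow> finite B \<Longrightarrow> u \<in> faces_in B \<Longrightarrow> idx B u < card (faces_in B)"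
  using idx_bij by (auto simp: bij_betw_def)

lemma dec:
  assumes "B \<subseteq> carrier M" "finite B" "i < card (faces_in B)"
  shows "dec B i \<in> faces_in B" "idx B (dec B i) = i"
proof -
  have "i \<in> idx B ` faces_in B" using idx_bij[OF assms(1,2)] assms(3) by (auto simp: bij_betw_def)
  then show "dec B i \<in> faces_in B" "idx B (dec B i) = i"
    unfolding dec_def by (rule inv_into_into, rule f_inv_into_f)
qed

lemma code_empty: "code B {} = 0"
  by (simp add: code_def)

lemma idx_empty: "idx B {} = 0"
  by (simp add: idx_def order_rank_def code_empty)

lemma idx_pos:
  assumes "B \<subseteq> carrier M" "finite B" "u \<in> faces_in B" "u \<noteq> {}"
  shows "0 < idx B u"
proof -
  have "code B u \<noteq> code B {}" using code_inj[OF assms(1,2)] assms(3,4) by (auto simp: faces_in_def)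
  then have "code B {} < code B u" by (simp add: code_empty)
  then show ?thesis using idx_less_iff[OF assms(1,2) empty_faces_in assms(3)] by (simp add: idx_empty)
qed

lemma dec_0: "B \<subseteq> carrier M \<Longrightarrow> finite B \<Longrightarrow> dec B 0 = {}"
  using dec_idx[OF _ _ empty_faces_in] by (simp add: idx_empty)

lemma first_occurrence:
  assumes B: "B \<subseteq> carrier M" "finite B" and w: "w \<in> pwords 1 (card (faces_in B)) n"
    and u: "u \<in> faces_in B" "u \<noteq> {}"
  obtains j where "j < n" "dec B (w ! j) = u" "\<And>i. i < j \<Longrightarrow> code B (dec B (w ! i)) < code B u"
proof -
  have "1 \<le> idx B u" using idx_pos[OF B u] by simp
  from pwords_split[OF w this idx_lt_card[OF B u(1)]]
  obtain ys zs where ys: "w = ys @ idx B u # zs" "set ys \<subseteq> {..<idx B u}" by metis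
  show ?thesis
  proof (rule that[of "length ys"])
    show "length ys < n" using pwordsD(2)[OF w] ys(1) by simp
    show "dec B (w ! length ys) = u" using dec_idx[OF B u(1)] by (simp add: ys(1))
    show "code B (dec B (w ! i)) < code B u" if "i < length ys" for i
    proof -
      have "w ! i \<in> set ys" using that by (simp add: ys(1) nth_append)
      then have "w ! i < idx B u" using ys(2) by blast
      then have "w ! i < card (faces_in B)" using idx_lt_card[OF B u(1)] by simp
      from dec[OF B this] show ?thesis
        using \<open>w ! i < idx B u\<close> idx_less_iff[OF B _ u(1), of "dec B (w ! i)"] by simp
    qed
  qed
qed

lemma bits_less: "bits B w v \<subseteq> {..<length w}"
  by (auto simp: bits_def)

lemma finite_bits: "finite (bits B w v)"
  by (rule finite_subset[OF bits_less]) simp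

lemma mem_bits: "j < length w \<Longrightarrow> length w - Suc j \<in> bits B w v \<longleftrightarrow> v \<in> dec B (w ! j)"
  by (auto simp: bits_def Suc_diff_Suc)

context
  fixes B w n
  assumes B: "B \<subseteq> carrier M" "finite B" and w: "w \<in> pwords 1 (card (faces_in B)) n"
begin

lemma singleton_faces_in: "v \<in> B \<Longrightarrow> {v} \<in> faces_in B"
  using face_singleton B(1) by (auto simp: faces_in_def)

lemma dec_letter: "j < n \<Longrightarrow> dec B (w ! j) \<in> faces_in B"
  using dec[OF B] pwordsD[OF w] by (metis lessThan_iff nth_mem subsetD)

lemma vertex_range: "v \<in> B \<Longrightarrow> vertex B w v \<in> {1..<2 ^ n}"
proof -
  assume v: "v \<in> B"
  obtain j where "j < n" "dec B (w ! j) = {v}"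
    using first_occurrence[OF B w singleton_faces_in[OF v]] by blast
  then have "n - Suc j \<in> bits B w v" using mem_bits[of j w] pwordsD(2)[OF w] by auto
  then have "bits B w v \<noteq> {}" by blast
  then have "vertex B w v \<noteq> 0"
    using set_encode_eq[OF finite_bits, of "{}"] by (auto simp: vertex_def)
  moreover have "vertex B w v < 2 ^ n"
    unfolding vertex_def using set_encode_less_power[OF bits_less] pwordsD(2)[OF w] by metis
  ultimately show ?thesis by simp
qed

text \<open>Up to the first occurrence of \<open>{v}\<close> all faces have code at most
  \<open>2 ^ rk B v\<close>, so none of them contains the vertex \<open>v'\<close> of higher rank.
  Hence all bits of \<open>v'\<close> lie below the bit that this occurrence gives to
  \<open>v\<close>.\<close>

lemma vertex_less:
  assumes v: "v \<in> B" "v' \<in> B" and lt: "lt M v v'"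
  shows "vertex B w v' < vertex B w v"
proof -
  obtain j where j: "j < n" "dec B (w ! j) = {v}"
    and before: "\<And>i. i < j \<Longrightarrow> code B (dec B (w ! i)) < code B {v}"
    using first_occurrence[OF B w singleton_faces_in[OF v(1)]] by blast
  have len: "length w = n" using pwordsD(2)[OF w] .
  have rk: "rk B v < rk B v'" using rk_less_iff[OF B v] lt by simp
  have "v' \<notin> dec B (w ! i)" if "i \<le> j" for i
  proof (cases "i = j")
    case True
    then show ?thesis using rk j(2) by auto
  next
    case False
    then have c: "code B (dec B (w ! i)) < 2 ^ rk B v" using before[of i] that by (simp add: code_def)
    show ?thesis
    proof
      assume "v' \<in> dec B (w ! i)"
      moreover have "dec B (w ! i) \<subseteq> B" using dec_letter[of i] that j(1) by (auto simp: faces_in_def)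
      then have "finite (dec B (w ! i))" using B(2) finite_subset by blast
      ultimately have "2 ^ rk B v' \<le> code B (dec B (w ! i))"
        unfolding code_def by (intro set_encode_ge_power) auto
      moreover have "(2::nat) ^ rk B v < 2 ^ rk B v'" using rk by simp
      ultimately show False using c by simp
    qed
  qed
  then have later: "j < i" if "v' \<in> dec B (w ! i)" for i
    using that by (meson not_le)
  have "bits B w v' \<subseteq> {..<n - Suc j}"
  proof
    fix b assume "b \<in> bits B w v'"
    then have "b < n" "j < n - Suc b" using later len by (auto simp: bits_def)
    then show "b \<in> {..<n - Suc j}" by auto
  qed
  then have "vertex B w v' < 2 ^ (n - Suc j)"
    unfolding vertex_def by (rule set_encode_less_power)
  also have "n - Suc j \<in> bits B w v" using mem_bits[of j w B v] j len by simp
  then have "2 ^ (n - Suc j) \<le> vertex B w v"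
    unfolding vertex_def by (intro set_encode_ge_power finite_bits)
  finally show ?thesis .
qed

text \<open>A common bit is a position whose face contains all of \<open>u\<close>, and subsets of
  faces are faces. Conversely, a nonempty face \<open>u\<close> occurs itself as a letter, which
  gives all its vertices a common bit.\<close>

lemma vertex_face:
  assumes u: "u \<subseteq> B"
  shows "face M u \<longleftrightarrow> u = {} \<or> card (vertex B w ` u) \<le> k \<and> (\<exists>b. \<forall>x\<in>vertex B w ` u. b \<in> set_decode x)"
proof (cases "u = {}")
  case False
  have len: "length w = n" using pwordsD(2)[OF w] .
  have dec_vertex: "set_decode (vertex B w v) = bits B w v" for v
    by (simp add: vertex_def finite_bits)
  show ?thesis
  proof
    assume f: "face M u"
    then have "u \<in> faces_in B" using u by (simp add: faces_in_def)
    from first_occurrence[OF B w this False] obtain j where j: "j < n" "dec B (w ! j) = u" by metis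
    then have "\<forall>v\<in>u. n - Suc j \<in> bits B w v" using mem_bits[of j w B] len by simp
    moreover have "card (vertex B w ` u) \<le> k"
      using card_image_le[OF face_finite[OF f], of "vertex B w"] face_card[OF f] by simp
    ultimately show "u = {} \<or> card (vertex B w ` u) \<le> k \<and> (\<exists>b. \<forall>x\<in>vertex B w ` u. b \<in> set_decode x)"
      by (auto simp: dec_vertex)
  next
    assume "u = {} \<or> card (vertex B w ` u) \<le> k \<and> (\<exists>b. \<forall>x\<in>vertex B w ` u. b \<in> set_decode x)"
    then obtain b where b: "\<forall>v\<in>u. b \<in> bits B w v" using False by (auto simp: dec_vertex)
    then have "b < n" "u \<subseteq> dec B (w ! (n - Suc b))" using False len by (auto simp: bits_def)
    then show "face M u"
      using dec_letter[of "n - Suc b"] face_hereditary by (auto simp: faces_in_def)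
  qed
qed (simp add: face_def)

end

section \<open>Traces along automorphisms and the Ramsey property\<close>

definition trace :: "'a set \<Rightarrow> ('a \<Rightarrow> 'a) \<Rightarrow> 'a set \<Rightarrow> 'a set" where
  "trace F g T = {x \<in> F. g x \<in> T}"

text \<open>Both \<open>rk F\<close> and \<open>rk B \<circ> g\<close> rank the vertices of
  \<open>F\<close> along \<open>lt M\<close>, so they order the codes of subsets of \<open>F\<close>
  alike.\<close>

lemma code_Aut_less:
  assumes g: "g \<in> carrier (Aut M)" and F: "F \<subseteq> carrier M" "finite F"
    and B: "B \<subseteq> carrier M" "finite B" and gF: "g ` F \<subseteq> B"
    and uv: "u \<subseteq> F" "v \<subseteq> F" "code F u < code F v"
  shows "code B (g ` u) < code B (g ` v)"
proof -
  have "inj_on g F" using Aut_bij[OF g] F(1) by (meson bij_betw_def inj_on_subset)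
  then have inj: "inj_on (rk B \<circ> g) F"
    using comp_inj_on inj_on_subset[OF rk_inj[OF B] gF] by blast
  have mono: "(rk B \<circ> g) x < (rk B \<circ> g) y" if xy: "x \<in> F" "y \<in> F" "rk F x < rk F y" for x y
  proof -
    have "lt M x y" using rk_less_iff[OF F xy(1,2)] xy(3) by simp
    then have "lt M (g x) (g y)" using Aut_lt[OF g] F(1) xy(1,2) by blast
    moreover have "g x \<in> B" "g y \<in> B" using gF xy by auto
    ultimately show ?thesis using rk_less_iff[OF B] by simp
  qed
  have "set_encode ((rk B \<circ> g) ` u) < set_encode ((rk B \<circ> g) ` v)"
    by (rule set_encode_image_mono[OF F(2) rk_inj[OF F] inj mono uv(1,2) uv(3)[unfolded code_def]])
  then show ?thesis by (simp add: code_def image_comp)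
qed

lemma trace_face:
  assumes g: "g \<in> carrier (Aut M)" and F: "F \<subseteq> carrier M" and T: "face M T"
  shows "trace F g T \<in> faces_in F"
proof -
  have "g ` trace F g T \<subseteq> T" by (auto simp: trace_def)
  then have "face M (g ` trace F g T)" using T face_hereditary by blast
  then have "face M (trace F g T)" using Aut_face[OF g, of "trace F g T"] F by (auto simp: trace_def)
  then show ?thesis by (auto simp: faces_in_def trace_def)
qed

text \<open>Entry \<open>i - 1\<close> belongs to face number \<open>i\<close> of \<open>B\<close>.
  The empty face needs no entry: its trace is empty, and \<open>plug 1\<close> leaves the letter 0
  alone.\<close>

definition copy_word :: "'a set \<Rightarrow> 'a set \<Rightarrow> ('a \<Rightarrow> 'a) \<Rightarrow> nat list" where
  "copy_word F B g = map (\<lambda>i. idx F (trace F g (dec B i))) [1..<card (faces_in B)]"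

text \<open>The first face of \<open>B\<close> with trace \<open>u\<close> is \<open>g ` u\<close>, since the order of the faces extends
  inclusion.\<close>

lemma copy_word_pwords:
  assumes g: "g \<in> carrier (Aut M)" and F: "F \<subseteq> carrier M" "finite F"
    and B: "B \<subseteq> carrier M" "finite B" and gF: "g ` F \<subseteq> B"
  shows "copy_word F B g \<in> pwords 1 (card (faces_in F)) (card (faces_in B) - 1)"
proof -
  have tr: "trace F g (dec B i) \<in> faces_in F" if "i < card (faces_in B)" for i
    using trace_face[OF g F(1)] dec(1)[OF B that] by (simp add: faces_in_def)
  have inj: "inj_on g F" using Aut_bij[OF g] F(1) by (meson bij_betw_def inj_on_subset)
  have "\<exists>ys zs. copy_word F B g = ys @ j # zs \<and> set ys \<subseteq> {..<j}"
    if j: "1 \<le> j" "j < card (faces_in F)" for j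
  proof -
    define u where "u = dec F j"
    have u: "u \<in> faces_in F" "idx F u = j" unfolding u_def using dec[OF F j(2)] by auto
    then have "u \<noteq> {}" using j(1) idx_empty by auto
    have "u \<subseteq> F" using u by (simp add: faces_in_def)
    then have gu: "g ` u \<in> faces_in B"
      using u(1) gF F(1) Aut_face[OF g, of u] by (auto simp: faces_in_def)
    define i where "i = idx B (g ` u)"
    have i: "0 < i" "i < card (faces_in B)"
      unfolding i_def using idx_pos[OF B gu] idx_lt_card[OF B gu] \<open>u \<noteq> {}\<close> by auto
    have "[1..<card (faces_in B)] = [1..<i] @ i # [Suc i..<card (faces_in B)]"
      using upt_add_eq_append[of 1 i "card (faces_in B) - i"] i by (simp add: upt_conv_Cons)
    moreover have "trace F g (dec B i) = u"
      using dec_idx[OF B gu] \<open>u \<subseteq> F\<close> inj unfolding i_def trace_def inj_on_def by auto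
    moreover have "idx F (trace F g (dec B i')) < j" if "i' < i" for i'
    proof -
      have i': "i' < card (faces_in B)" using that i(2) by simp
      define T where "T = dec B i'"
      have T: "T \<in> faces_in B" "idx B T = i'" unfolding T_def using dec[OF B i'] by auto
      have t: "trace F g T \<in> faces_in F" unfolding T_def by (rule tr[OF i'])
      have "code B T < code B (g ` u)"
        using idx_less_iff[OF B T(1) gu] T(2) that by (simp add: i_def)
      moreover have "code B (g ` trace F g T) \<le> code B T"
      proof -
        have "g ` trace F g T \<subseteq> T" by (auto simp: trace_def)
        moreover have "finite T" using T(1) face_finite by (simp add: faces_in_def)
        ultimately show ?thesis unfolding code_def by (intro set_encode_le_subset) auto
      qed
      ultimately have less: "code B (g ` trace F g T) < code B (g ` u)" by simp
      have "trace F g T \<subseteq> F" by (auto simp: trace_def)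
      then have "\<not> code F u < code F (trace F g T)"
        using code_Aut_less[OF g F B gF \<open>u \<subseteq> F\<close>, of "trace F g T"] less by (meson less_asym)
      moreover have "code F u \<noteq> code F (trace F g T)"
        using code_inj[OF F \<open>u \<subseteq> F\<close> \<open>trace F g T \<subseteq> F\<close>] less by auto
      ultimately have "code F (trace F g T) < code F u" by simp
      then show ?thesis using idx_less_iff[OF F t u(1)] u(2) by (simp add: T_def)
    qed
    ultimately show ?thesis
      using u(2) unfolding copy_word_def
      by (intro exI[of _ "map (\<lambda>i. idx F (trace F g (dec B i))) [1..<i]"]
          exI[of _ "map (\<lambda>i. idx F (trace F g (dec B i))) [Suc i..<card (faces_in B)]"]) auto
  qed
  moreover have "1 \<le> card (faces_in F)"
    using empty_faces_in faces_in_finite[OF F(2)] by (metis One_nat_def Suc_leI card_gt_0_iff empty_iff)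
  moreover have "set (copy_word F B g) \<subseteq> {..<card (faces_in F)}"
    using idx_lt_card[OF F tr] by (auto simp: copy_word_def)
  ultimately show ?thesis by (auto simp: pwords_def copy_word_def)
qed

text \<open>A vertex \<open>x\<close> lies in the trace of a face iff \<open>g x\<close> lies in the
  face, so both sides have the same bit at every position. Substitution into \<open>W\<close> thus
  realizes the composition of the vertex map of \<open>W\<close> with \<open>g\<close>.\<close>

lemma vertex_copy_word:
  assumes g: "g \<in> carrier (Aut M)" and F: "F \<subseteq> carrier M" "finite F"
    and B: "B \<subseteq> carrier M" "finite B" and gF: "g ` F \<subseteq> B"
    and W: "W \<in> pwords 1 (card (faces_in B)) n" and x: "x \<in> F"
  shows "vertex F (plug 1 (copy_word F B g) W) x = vertex B W (g x)"
proof -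
  have len: "length W = n" using pwordsD(2)[OF W] .
  have "x \<in> dec F (plug 1 (copy_word F B g) W ! j) \<longleftrightarrow> g x \<in> dec B (W ! j)" if "j < n" for j
  proof -
    have Wj: "W ! j < card (faces_in B)" using pwordsD[OF W] that by (metis lessThan_iff nth_mem subsetD)
    have "plug 1 (copy_word F B g) W ! j = idx F (trace F g (dec B (W ! j)))"
    proof (cases "W ! j = 0")
      case True
      then show ?thesis using that len by (simp add: plug_def dec_0[OF B] trace_def idx_empty)
    next
      case False
      then have "[1..<card (faces_in B)] ! (W ! j - 1) = W ! j"
        using Wj by (subst nth_upt) auto
      then show ?thesis using False that len Wj by (simp add: plug_def copy_word_def)
    qed
    moreover have "trace F g (dec B (W ! j)) \<in> faces_in F"
      using trace_face[OF g F(1)] dec(1)[OF B Wj] by (simp add: faces_in_def)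
    ultimately have "dec F (plug 1 (copy_word F B g) W ! j) = trace F g (dec B (W ! j))"
      using dec_idx[OF F] by simp
    then show ?thesis using x by (simp add: trace_def)
  qed
  then have "bits F (plug 1 (copy_word F B g) W) x = bits B W (g x)"
    unfolding bits_def length_plug len by force
  then show ?thesis by (simp add: vertex_def)
qed

text \<open>\<open>B\<close> is the union of the copies of \<open>F\<close> given by
  \<open>E\<close>. A word over the faces of \<open>F\<close> is coloured like the embedding it
  defines, and a monochromatic \<open>W\<close> over the faces of \<open>B\<close> embeds
  \<open>B\<close> so that all these copies get one colour.\<close>

theorem Aut_Ramsey:
  assumes F: "F \<subseteq> carrier M" "finite F" and E: "E \<subseteq> carrier (Aut M)" "finite E"
    and c: "\<And>e. c e < (r::nat)"
  shows "\<exists>h\<in>carrier (Aut M). \<forall>g\<in>E. \<forall>g'\<in>E. c (\<lambda>x\<in>F. h (g x)) = c (\<lambda>x\<in>F. h (g' x))"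
proof -
  define B where "B = (\<Union>g\<in>E. g ` F)"
  have "g x \<in> carrier M" if "g \<in> E" "x \<in> F" for g x
    using Aut_bij[of g] E(1) F(1) that by (meson bij_betwE subsetD)
  then have B: "B \<subseteq> carrier M" "finite B"
    unfolding B_def using E(2) F(2) by auto
  have gF: "g ` F \<subseteq> B" if "g \<in> E" for g using that by (auto simp: B_def)
  have pos: "1 \<le> card (faces_in C)" if "finite C" for C
    using empty_faces_in faces_in_finite[OF that] by (metis One_nat_def Suc_leI card_gt_0_iff empty_iff)
  define p where "p = card (faces_in B) - 1"
  have p: "1 + p = card (faces_in B)" using pos[OF B(2)] by (simp add: p_def)
  obtain n where n: "\<And>c. (\<forall>x\<in>pwords 1 (card (faces_in F)) n. c x < r) \<Longrightarrow>
      param_mono 1 (card (faces_in F)) p n c"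
    using Graham_Rothschild[OF pos[OF F(2)] zero_less_one, of r p] by blast
  obtain \<rho> where \<rho>: "\<rho> ` {1..<2 ^ n} \<subseteq> carrier M"
    "\<And>u. u \<subseteq> {1..<2 ^ n} \<Longrightarrow> face M (\<rho> ` u) \<longleftrightarrow> u = {} \<or> card u \<le> k \<and> (\<exists>b. \<forall>x\<in>u. b \<in> set_decode x)"
    "\<And>x y. x \<in> {1..<2 ^ n} \<Longrightarrow> y \<in> {1..<2 ^ n} \<Longrightarrow> y < x \<Longrightarrow> lt M (\<rho> x) (\<rho> y)"
    using embed_nerve[of n] by blast
  have "param_mono 1 (card (faces_in F)) p n (\<lambda>s. c (\<lambda>x\<in>F. \<rho> (vertex F s x)))"
    by (rule n) (simp add: c)
  then obtain W where W: "W \<in> pwords 1 (card (faces_in B)) n" and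
    mono: "\<And>w w'. w \<in> pwords 1 (card (faces_in F)) p \<Longrightarrow> w' \<in> pwords 1 (card (faces_in F)) p \<Longrightarrow>
      c (\<lambda>x\<in>F. \<rho> (vertex F (plug 1 w W) x)) = c (\<lambda>x\<in>F. \<rho> (vertex F (plug 1 w' W) x))"
    unfolding param_mono_def p by blast
  note range = vertex_range[OF B W]
  \<comment> \<open>The embedding of \<open>B\<close> given by \<open>W\<close> is realized by an
    automorphism \<open>h\<close>; on \<open>F\<close> the map \<open>h \<circ> g\<close> is then
    the embedding given by \<open>W\<close> with \<open>copy_word F B g\<close> substituted.\<close>
  have "\<exists>h\<in>carrier (Aut M). \<forall>x\<in>B. h x = (\<rho> \<circ> vertex B W) x"
  proof (rule extend_embedding[OF B, of "\<rho> \<circ> vertex B W"])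
    show "(\<rho> \<circ> vertex B W) ` B \<subseteq> carrier M" using range \<rho>(1) by auto
    show "face M ((\<rho> \<circ> vertex B W) ` u) \<longleftrightarrow> face M u" if "u \<subseteq> B" for u
    proof -
      have "vertex B W ` u \<subseteq> {1..<2 ^ n}" using range that by blast
      from \<rho>(2)[OF this] vertex_face[OF B W that] show ?thesis by (simp add: image_comp)
    qed
    show "lt M ((\<rho> \<circ> vertex B W) x) ((\<rho> \<circ> vertex B W) y)" if "x \<in> B" "y \<in> B" "lt M x y" for x y
      using \<rho>(3) range vertex_less[OF B W] that by simp
    show "\<exists>h\<in>carrier (Aut M). \<forall>x\<in>B. h x = (\<rho> \<circ> vertex B W) x"
      if "h \<in> carrier (Aut M)" "\<And>x. x \<in> B \<Longrightarrow> h x = (\<rho> \<circ> vertex B W) x" for h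
      using that by blast
  qed
  then obtain h where h: "h \<in> carrier (Aut M)" "\<And>x. x \<in> B \<Longrightarrow> h x = (\<rho> \<circ> vertex B W) x"
    by blast
  have "(\<lambda>x\<in>F. h (g x)) = (\<lambda>x\<in>F. \<rho> (vertex F (plug 1 (copy_word F B g) W) x))" if "g \<in> E" for g
    using vertex_copy_word[OF _ F B gF W] h(2) gF that E(1) by (intro restrict_ext) (auto simp: subset_iff)
  moreover have "copy_word F B g \<in> pwords 1 (card (faces_in F)) p" if "g \<in> E" for g
    unfolding p_def using copy_word_pwords[OF _ F B gF] that E(1) by blast
  ultimately show ?thesis using h(1) mono by (intro bexI[OF _ h(1)]) simp
qed

end


section \<open>Automorphism groups and fixed points\<close>

lemma carrier_Aut: "carrier (Aut M) = {f \<in> Bij (carrier M). isomorphism M M f}"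
  by (simp add: Aut_def)

lemma subgroup_Aut: "subgroup (carrier (Aut M)) (BijGroup (carrier M))"
proof -
  let ?C = "carrier M"
  interpret group "BijGroup ?C" by (rule group_BijGroup)
  have iso: "xs \<in> rel M s \<longleftrightarrow> map f xs \<in> rel M s" if "f \<in> carrier (Aut M)" "set xs \<subseteq> ?C" for f xs s
    using that by (auto simp: carrier_Aut isomorphism_def)
  have isoI: "f \<in> carrier (Aut M)"
    if "f \<in> Bij ?C" "\<And>xs s. set xs \<subseteq> ?C \<Longrightarrow> xs \<in> rel M s \<longleftrightarrow> map f xs \<in> rel M s" for f
    using that by (auto simp: carrier_Aut isomorphism_def Bij_def)
  have Bij: "f \<in> Bij ?C" if "f \<in> carrier (Aut M)" for f using that by (simp add: carrier_Aut)
  show ?thesis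
  proof (rule subgroupI)
    show "carrier (Aut M) \<subseteq> carrier (BijGroup ?C)" using Bij by (auto simp: BijGroup_def)
    have "(\<lambda>x\<in>?C. x) \<in> carrier (Aut M)"
    proof (rule isoI[OF id_Bij])
      fix xs s assume "set xs \<subseteq> ?C"
      then have "map (\<lambda>x\<in>?C. x) xs = xs" by (intro map_idI) auto
      then show "xs \<in> rel M s \<longleftrightarrow> map (\<lambda>x\<in>?C. x) xs \<in> rel M s" by simp
    qed
    then show "carrier (Aut M) \<noteq> {}" by blast
  next
    fix f assume f: "f \<in> carrier (Aut M)"
    let ?g = "\<lambda>x\<in>?C. inv_into ?C f x"
    have im: "f ` ?C = ?C" using Bij[OF f] by (simp add: Bij_def bij_betw_def)
    have "?g \<in> carrier (Aut M)"
    proof (rule isoI[OF restrict_inv_into_Bij[OF Bij[OF f]]])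
      fix xs s assume xs: "set xs \<subseteq> ?C"
      have "map f (map ?g xs) = xs"
        using xs im by (simp, intro map_idI) (auto simp: f_inv_into_f subset_iff)
      moreover have "set (map ?g xs) \<subseteq> ?C"
        using xs im by (auto simp: inv_into_into subset_iff)
      ultimately show "xs \<in> rel M s \<longleftrightarrow> map ?g xs \<in> rel M s"
        using iso[OF f, of "map ?g xs" s] by simp
    qed
    then show "inv\<^bsub>BijGroup ?C\<^esub> f \<in> carrier (Aut M)"
      using inv_BijGroup[OF Bij[OF f]] by simp
  next
    fix f g assume f: "f \<in> carrier (Aut M)" and g: "g \<in> carrier (Aut M)"
    have "compose ?C f g \<in> carrier (Aut M)"
    proof (rule isoI[OF compose_Bij[OF Bij Bij, OF f g]])
      fix xs s assume xs: "set xs \<subseteq> ?C"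
      have "map (compose ?C f g) xs = map f (map g xs)"
        using xs by (auto simp: compose_def)
      moreover have "set (map g xs) \<subseteq> ?C"
        using xs Bij_imp_funcset[OF Bij[OF g]] by auto
      ultimately show "xs \<in> rel M s \<longleftrightarrow> map (compose ?C f g) xs \<in> rel M s"
        using iso[OF g xs] iso[OF f] by metis
    qed
    then show "f \<otimes>\<^bsub>BijGroup ?C\<^esub> g \<in> carrier (Aut M)"
      using Bij[OF f] Bij[OF g] by (simp add: BijGroup_def)
  qed
qed

lemma group_Aut: "group (Aut M)"
  using subgroup.subgroup_is_group[OF subgroup_Aut[of M] group_BijGroup] by (simp add: Aut_def)

lemma Aut_closed: "g \<in> carrier (Aut M) \<Longrightarrow> x \<in> carrier M \<Longrightarrow> g x \<in> carrier M"
  using Bij_imp_funcset[of g "carrier M"] by (auto simp: carrier_Aut)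

lemma Aut_mult:
  assumes "g \<in> carrier (Aut M)" "h \<in> carrier (Aut M)" "x \<in> carrier M"
  shows "(g \<otimes>\<^bsub>Aut M\<^esub> h) x = g (h x)"
proof -
  have "g \<otimes>\<^bsub>Aut M\<^esub> h = compose (carrier M) g h"
    using assms(1,2) by (simp add: Aut_def BijGroup_def)
  then show ?thesis using assms(3) by (simp add: compose_eq)
qed

lemma Aut_one: "x \<in> carrier M \<Longrightarrow> \<one>\<^bsub>Aut M\<^esub> x = x"
  by (simp add: Aut_def BijGroup_def)

lemma Aut_inv_apply:
  assumes "g \<in> carrier (Aut M)" "x \<in> carrier M"
  shows "g ((inv\<^bsub>Aut M\<^esub> g) x) = x" "(inv\<^bsub>Aut M\<^esub> g) (g x) = x"
proof -
  interpret group "Aut M" by (rule group_Aut)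
  show "g ((inv\<^bsub>Aut M\<^esub> g) x) = x" "(inv\<^bsub>Aut M\<^esub> g) (g x) = x"
    using assms Aut_mult[of g M "inv\<^bsub>Aut M\<^esub> g" x] Aut_mult[of "inv\<^bsub>Aut M\<^esub> g" M g x] Aut_one[of x M]
    by simp_all
qed

section \<open>The topology of pointwise convergence\<close>

lemma topspace_pointwise: "topspace (pointwise_topology M) = carrier (Aut M)"
  by (auto simp: pointwise_topology_def carrier_Aut Bij_def bij_betw_def PiE_iff extensional_def)

lemma openin_pointwise_eval:
  assumes "x \<in> carrier M"
  shows "openin (pointwise_topology M) {g \<in> carrier (Aut M). g x = y}"
proof (cases "y \<in> carrier M")
  case True
  have "continuous_map (pointwise_topology M) (discrete_topology (carrier M)) (\<lambda>g. g x)"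
    unfolding pointwise_topology_def
    by (intro continuous_map_from_subtopology continuous_map_product_projection assms)
  from openin_continuous_map_preimage[OF this, of "{y}"] True
  show ?thesis by (simp add: topspace_pointwise)
next
  case False
  then have "{g \<in> carrier (Aut M). g x = y} = {}" using Aut_closed[OF _ assms] by blast
  then show ?thesis by (simp only: openin_empty)
qed

lemma continuous_map_pointwise:
  assumes f: "f ` topspace X \<subseteq> carrier (Aut M)"
    and op: "\<And>x y. x \<in> carrier M \<Longrightarrow> y \<in> carrier M \<Longrightarrow> openin X {p \<in> topspace X. f p x = y}"
  shows "continuous_map X (pointwise_topology M) f"
  unfolding pointwise_topology_def continuous_map_in_subtopology
proof (intro conjI)
  show "f \<in> topspace X \<rightarrow> carrier (Aut M)" using f by auto
  show "continuous_map X (product_topology (\<lambda>_. discrete_topology (carrier M)) (carrier M)) f"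
    unfolding continuous_map_componentwise
  proof (intro conjI ballI)
    show "f ` topspace X \<subseteq> extensional (carrier M)"
      using f by (auto simp: carrier_Aut Bij_def)
    fix x assume x: "x \<in> carrier M"
    have "openin X {p \<in> topspace X. f p x \<in> U}" if "U \<subseteq> carrier M" for U
    proof -
      have "{p \<in> topspace X. f p x \<in> U} = (\<Union>y\<in>U. {p \<in> topspace X. f p x = y})" by blast
      moreover have "openin X (\<Union>y\<in>U. {p \<in> topspace X. f p x = y})"
        using op[OF x] that by (intro openin_Union) auto
      ultimately show ?thesis by simp
    qed
    then show "continuous_map X (discrete_topology (carrier M)) (\<lambda>p. f p x)"
      using f Aut_closed[OF _ x] by (auto simp: continuous_map_def)
  qed
qed

lemma topological_group_Aut: "topological_group (Aut M) (pointwise_topology M)"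
  unfolding topological_group_def
proof (intro conjI)
  let ?T = "pointwise_topology M"
  interpret group "Aut M" by (rule group_Aut)
  show "group (Aut M)" by (rule group_Aut)
  show "topspace ?T = carrier (Aut M)" by (rule topspace_pointwise)
  show "continuous_map (prod_topology ?T ?T) ?T (\<lambda>(g, h). g \<otimes>\<^bsub>Aut M\<^esub> h)"
  proof (rule continuous_map_pointwise)
    show "(\<lambda>(g, h). g \<otimes>\<^bsub>Aut M\<^esub> h) ` topspace (prod_topology ?T ?T) \<subseteq> carrier (Aut M)"
      by (auto simp: topspace_pointwise)
    fix x y assume xy: "x \<in> carrier M" "y \<in> carrier M"
    \<comment> \<open>The condition \<open>g (h x) = y\<close> is split by the value
      \<open>z = h x\<close>, which yields a union of open rectangles.\<close>
    have "{p \<in> topspace (prod_topology ?T ?T). (case p of (g, h) \<Rightarrow> g \<otimes>\<^bsub>Aut M\<^esub> h) x = y} =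
      (\<Union>z\<in>carrier M. {g \<in> carrier (Aut M). g z = y} \<times> {h \<in> carrier (Aut M). h x = z})"
      using xy Aut_closed by (auto simp: topspace_pointwise Aut_mult)
    moreover have "openin (prod_topology ?T ?T)
      (\<Union>z\<in>carrier M. {g \<in> carrier (Aut M). g z = y} \<times> {h \<in> carrier (Aut M). h x = z})"
      using openin_pointwise_eval xy(1) by (intro openin_Union) (auto simp: openin_prod_Times_iff)
    ultimately show "openin (prod_topology ?T ?T)
        {p \<in> topspace (prod_topology ?T ?T). (case p of (g, h) \<Rightarrow> g \<otimes>\<^bsub>Aut M\<^esub> h) x = y}"
      by simp
  qed
  show "continuous_map ?T ?T (\<lambda>g. inv\<^bsub>Aut M\<^esub> g)"
  proof (rule continuous_map_pointwise)
    show "(\<lambda>g. inv\<^bsub>Aut M\<^esub> g) ` topspace ?T \<subseteq> carrier (Aut M)"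
      by (auto simp: topspace_pointwise)
    fix x y assume xy: "x \<in> carrier M" "y \<in> carrier M"
    have "(inv\<^bsub>Aut M\<^esub> g) x = y \<longleftrightarrow> g y = x" if "g \<in> carrier (Aut M)" for g
      using Aut_inv_apply(1)[OF that xy(1)] Aut_inv_apply(2)[OF that xy(2)] by metis
    then have "{g \<in> topspace ?T. (inv\<^bsub>Aut M\<^esub> g) x = y} = {g \<in> carrier (Aut M). g y = x}"
      unfolding topspace_pointwise by (intro Collect_cong conj_cong) auto
    then show "openin ?T {g \<in> topspace ?T. (inv\<^bsub>Aut M\<^esub> g) x = y}"
      using openin_pointwise_eval[OF xy(2)] by simp
  qed
qed

text \<open>A basic open set of the product restricts only finitely many coordinates, and these form
  \<open>F\<close>.\<close>

lemma stabilizer_in_nbhd: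
  assumes W: "openin (pointwise_topology M) W" "\<one>\<^bsub>Aut M\<^esub> \<in> W"
  obtains F where "F \<subseteq> carrier M" "finite F"
    "\<And>g. g \<in> carrier (Aut M) \<Longrightarrow> (\<And>x. x \<in> F \<Longrightarrow> g x = x) \<Longrightarrow> g \<in> W"
proof -
  let ?P = "product_topology (\<lambda>_. discrete_topology (carrier M)) (carrier M)"
  obtain W' where W': "openin ?P W'" "W = W' \<inter> carrier (Aut M)"
    using W(1) unfolding pointwise_topology_def openin_subtopology by blast
  have "\<one>\<^bsub>Aut M\<^esub> \<in> W'" using W(2) W'(2) by blast
  then obtain U where U: "finite {i \<in> carrier M. U i \<noteq> carrier M}"
    "\<one>\<^bsub>Aut M\<^esub> \<in> PiE (carrier M) U" "PiE (carrier M) U \<subseteq> W'"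
    using W'(1) unfolding openin_product_topology_alt by (metis (no_types, lifting) topspace_discrete_topology Collect_cong)
  show ?thesis
  proof (rule that[OF _ U(1)])
    fix g assume g: "g \<in> carrier (Aut M)" "\<And>x. x \<in> {i \<in> carrier M. U i \<noteq> carrier M} \<Longrightarrow> g x = x"
    have "g x \<in> U x" if x: "x \<in> carrier M" for x
    proof (cases "U x = carrier M")
      case True
      then show ?thesis using Aut_closed[OF g(1) x] by simp
    next
      case False
      have "\<one>\<^bsub>Aut M\<^esub> x \<in> U x" using U(2) x by auto
      then show ?thesis using g(2)[of x] False x by (simp add: Aut_one)
    qed
    then have "g \<in> PiE (carrier M) U" using g(1) by (auto simp: carrier_Aut Bij_def PiE_iff)
    then show "g \<in> W" using U(3) W'(2) g(1) by blast
  qed auto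
qed

text \<open>Maps on \<open>F\<close> stand for left cosets of the pointwise stabilizer of
  \<open>F\<close>, as two automorphisms agree on \<open>F\<close> iff they lie in the same
  coset.\<close>

definition Ramsey_orbits :: "('r, 'a) rstruct \<Rightarrow> bool" where
  "Ramsey_orbits M \<longleftrightarrow> (\<forall>F E (c :: ('a \<Rightarrow> 'a) \<Rightarrow> nat) r.
     F \<subseteq> carrier M \<longrightarrow> finite F \<longrightarrow> E \<subseteq> carrier (Aut M) \<longrightarrow> finite E \<longrightarrow> (\<forall>e. c e < r) \<longrightarrow>
     (\<exists>h\<in>carrier (Aut M). \<forall>g\<in>E. \<forall>g'\<in>E. c (\<lambda>x\<in>F. h (g x)) = c (\<lambda>x\<in>F. h (g' x))))"

lemma Ramsey_orbits_colour:
  assumes "Ramsey_orbits M" "F \<subseteq> carrier M" "finite F" "E \<subseteq> carrier (Aut M)" "finite E"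
    and "finite C" "\<And>e. c e \<in> C"
  shows "\<exists>h\<in>carrier (Aut M). \<forall>g\<in>E. \<forall>g'\<in>E. c (\<lambda>x\<in>F. h (g x)) = c (\<lambda>x\<in>F. h (g' x))"
proof -
  obtain c' :: "('a \<Rightarrow> 'a) \<Rightarrow> nat" where c': "\<forall>e\<in>UNIV. c' e < card C"
    "\<forall>e\<in>UNIV. \<forall>e'\<in>UNIV. c' e = c' e' \<longrightarrow> c e = c e'"
    using recolour[OF assms(6), of UNIV c] assms(7) by blast
  have "\<forall>e. c' e < card C" using c'(1) by simp
  then obtain h where "h \<in> carrier (Aut M)"
    "\<forall>g\<in>E. \<forall>g'\<in>E. c' (\<lambda>x\<in>F. h (g x)) = c' (\<lambda>x\<in>F. h (g' x))"
    using assms(1)[unfolded Ramsey_orbits_def, rule_format, OF assms(2-5)] by blast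
  then show ?thesis using c'(2) by blast
qed

text \<open>The colour of \<open>g\<inverse>\<close> on \<open>F\<close> records which of the finitely many given sets contain
  \<open>g x\<^sub>0\<close>; by the tube lemma it determines the position of \<open>g x\<^sub>0\<close> up to the given precision.\<close>

lemma fixed_point:
  fixes M :: "('r, 'a) rstruct"
  assumes Ram: "Ramsey_orbits M"
    and X: "topspace X \<noteq> {}" "compact_space X" "Hausdorff_space X"
    and act: "group_action (Aut M) (topspace X) \<phi>"
    and cont: "continuous_map (prod_topology (pointwise_topology M) X) X (\<lambda>(g, x). \<phi> g x)"
  shows "\<exists>x\<in>topspace X. \<forall>g\<in>carrier (Aut M). \<phi> g x = x"
proof -
  let ?G = "carrier (Aut M)" and ?T = "pointwise_topology M"
  interpret group "Aut M" by (rule group_Aut)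
  interpret group_action "Aut M" "topspace X" \<phi> by (rule act)
  have im: "\<phi> g x \<in> topspace X" if "g \<in> ?G" "x \<in> topspace X" for g x
    using element_image that by blast
  have phi_one: "\<phi> \<one>\<^bsub>Aut M\<^esub> x = x" if "x \<in> topspace X" for x
    using id_eq_one that by (metis restrict_apply')
  \<comment> \<open>\<open>C (g, U, V)\<close> excludes the points of \<open>U\<close> that
    \<open>g\<close> moves into \<open>V\<close>. A point in all these sets is fixed, and being
    closed they allow it to be found by compactness. The disjoint closed sets \<open>K\<close> and
    \<open>L\<close> make room for the tube lemma.\<close>
  define \<T> where "\<T> = {(g, U, V). g \<in> ?G \<and> openin X U \<and> openin X V \<and>
    (\<exists>K L. closedin X K \<and> closedin X L \<and> U \<subseteq> K \<and> V \<subseteq> L \<and> disjnt K L)}"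
  define C where "C = (\<lambda>(g, U, V). {x \<in> topspace X. \<not> (x \<in> U \<and> \<phi> g x \<in> V)})"
  have closed: "closedin X (C t)" if t: "t \<in> \<T>" for t
  proof -
    obtain g U V where t: "t = (g, U, V)" "g \<in> ?G" "openin X U" "openin X V"
      using t by (auto simp: \<T>_def)
    have "continuous_map X (prod_topology ?T X) (\<lambda>x. (g, x))"
      using t(2) by (simp add: continuous_map_pairedI topspace_pointwise)
    from continuous_map_compose[OF this cont] have "continuous_map X X (\<phi> g)"
      by (simp add: comp_def)
    then have "openin X {x \<in> topspace X. \<phi> g x \<in> V}"
      using t(4) by (rule openin_continuous_map_preimage)
    then have "openin X (U \<inter> {x \<in> topspace X. \<phi> g x \<in> V})"
      using t(3) by blast
    moreover have "C t = topspace X - U \<inter> {x \<in> topspace X. \<phi> g x \<in> V}"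
      unfolding t(1) C_def by auto
    ultimately show ?thesis by (simp add: closedin_diff)
  qed
  \<comment> \<open>The identity moves no point of \<open>K\<close> into \<open>L\<close>; by
    compactness neither does any automorphism near it, in particular none that fixes a suitable
    finite set pointwise.\<close>
  have stab: "\<exists>F\<subseteq>carrier M. finite F \<and> (\<forall>s\<in>?G. (\<forall>y\<in>F. s y = y) \<longrightarrow>
      (\<forall>z\<in>topspace X. \<not> (z \<in> fst (snd t) \<and> \<phi> s z \<in> snd (snd t))))" if t: "t \<in> \<T>" for t
  proof -
    obtain g U V K L where t: "t = (g, U, V)" and K: "closedin X K" "closedin X L" "U \<subseteq> K" "V \<subseteq> L" "disjnt K L"
      using t by (auto simp: \<T>_def)
    let ?P = "prod_topology ?T X"
    define W where "W = topspace ?P - {p \<in> topspace ?P. snd p \<in> K} \<inter> {p \<in> topspace ?P. (\<lambda>(g, x). \<phi> g x) p \<in> L}"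
    have "closedin ?P {p \<in> topspace ?P. snd p \<in> K}"
      by (rule closedin_continuous_map_preimage[OF continuous_map_snd K(1)])
    moreover have "closedin ?P {p \<in> topspace ?P. (\<lambda>(g, x). \<phi> g x) p \<in> L}"
      by (rule closedin_continuous_map_preimage[OF cont K(2)])
    ultimately have W: "openin ?P W"
      unfolding W_def by (intro openin_diff openin_topspace closedin_Int)
    have "{\<one>\<^bsub>Aut M\<^esub>} \<times> topspace X \<subseteq> W"
      unfolding W_def using K(5) phi_one by (auto simp: topspace_pointwise disjnt_iff)
    then obtain N V' where N: "openin ?T N" "\<one>\<^bsub>Aut M\<^esub> \<in> N" "topspace X \<subseteq> V'" "N \<times> V' \<subseteq> W"
      using tube_lemma_right[OF W, of "topspace X" "\<one>\<^bsub>Aut M\<^esub>"] X(2)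
      by (auto simp: compact_space_def topspace_pointwise)
    obtain F where F: "F \<subseteq> carrier M" "finite F"
      "\<And>g. g \<in> ?G \<Longrightarrow> (\<And>x. x \<in> F \<Longrightarrow> g x = x) \<Longrightarrow> g \<in> N"
      using stabilizer_in_nbhd[OF N(1,2)] by metis
    have "\<not> (z \<in> U \<and> \<phi> s z \<in> V)" if s: "s \<in> ?G" "\<forall>y\<in>F. s y = y" and z: "z \<in> topspace X" for s z
    proof -
      have "s \<in> N" using F(3) s by blast
      then have "(s, z) \<in> W" using N(3,4) z by blast
      then show ?thesis using K(3,4) z s(1) by (auto simp: W_def topspace_pointwise)
    qed
    then show ?thesis using F(1,2) by (intro exI[of _ F]) (simp add: t)
  qed
  obtain x0 where x0: "x0 \<in> topspace X" using X(1) by blast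
  have fip: "\<Inter>(C ` T0) \<noteq> {}" if T0: "T0 \<subseteq> \<T>" "finite T0" for T0
  proof -
    obtain F where F: "\<And>t. t \<in> \<T> \<Longrightarrow> F t \<subseteq> carrier M" "\<And>t. t \<in> \<T> \<Longrightarrow> finite (F t)"
      "\<And>t s z. t \<in> \<T> \<Longrightarrow> s \<in> ?G \<Longrightarrow> (\<forall>y\<in>F t. s y = y) \<Longrightarrow> z \<in> topspace X \<Longrightarrow>
        \<not> (z \<in> fst (snd t) \<and> \<phi> s z \<in> snd (snd t))"
      using stab by metis
    define F0 where "F0 = (\<Union>t\<in>T0. F t)"
    have F0: "F0 \<subseteq> carrier M" "finite F0"
      unfolding F0_def using F(1,2) T0 by (blast, auto)
    \<comment> \<open>If \<open>s\<close> fixes \<open>F0\<close> pointwise, then \<open>g\<close>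
      and \<open>s\<close> after \<open>g\<close> bring \<open>x0\<close> to nearby points. Passing
      to inverses turns such right cosets into the left cosets that are coloured.\<close>
    define c where "c e = {t \<in> T0. \<exists>g\<in>?G. (\<forall>y\<in>F0. (inv\<^bsub>Aut M\<^esub> g) y = e y) \<and> \<phi> g x0 \<in> fst (snd t)}" for e
    \<comment> \<open>The identity and the inverse of \<open>g\<close> yield equal colours for
      \<open>h\<close> and for \<open>h\<close> composed with that inverse, which compares
      \<open>x\<close> with its image under \<open>g\<close>.\<close>
    define E where "E = insert \<one>\<^bsub>Aut M\<^esub> ((\<lambda>t. inv\<^bsub>Aut M\<^esub> (fst t)) ` T0)"
    have G0: "fst t \<in> ?G" if "t \<in> T0" for t using that T0(1) by (auto simp: \<T>_def)
    have E: "E \<subseteq> ?G" "finite E" unfolding E_def using G0 T0(2) by auto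
    have "finite (Pow T0)" "\<And>e. c e \<in> Pow T0" using T0(2) by (auto simp: c_def)
    from Ramsey_orbits_colour[OF Ram F0 E this] obtain h where h: "h \<in> ?G"
      and hc: "\<forall>g\<in>E. \<forall>g'\<in>E. c (\<lambda>x\<in>F0. h (g x)) = c (\<lambda>x\<in>F0. h (g' x))"
      by (rule bexE)
    define x where "x = \<phi> (inv\<^bsub>Aut M\<^esub> h) x0"
    have x: "x \<in> topspace X" unfolding x_def by (rule im[OF inv_closed[OF h] x0])
    have "x \<in> C t" if t: "t \<in> T0" for t
    proof -
      obtain g U V where tg: "t = (g, U, V)" by (cases t) auto
      have g: "g \<in> ?G" using G0[OF t] by (simp add: tg)
      have "\<not> (x \<in> U \<and> \<phi> g x \<in> V)"
      proof
        assume xUV: "x \<in> U \<and> \<phi> g x \<in> V"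
        have "(inv\<^bsub>Aut M\<^esub> (inv\<^bsub>Aut M\<^esub> h)) y = (\<lambda>x\<in>F0. h (\<one>\<^bsub>Aut M\<^esub> x)) y" if "y \<in> F0" for y
          using that h F0(1) by (auto simp: Aut_one)
        then have "t \<in> c (\<lambda>x\<in>F0. h (\<one>\<^bsub>Aut M\<^esub> x))"
          unfolding c_def using t h xUV by (auto simp: tg x_def intro!: bexI[of _ "inv\<^bsub>Aut M\<^esub> h"])
        also have "c (\<lambda>x\<in>F0. h (\<one>\<^bsub>Aut M\<^esub> x)) = c (\<lambda>x\<in>F0. h ((inv\<^bsub>Aut M\<^esub> g) x))"
          by (rule hc[rule_format]) (use t tg in \<open>force simp: E_def\<close>)+
        finally obtain g' where g': "g' \<in> ?G" "\<phi> g' x0 \<in> U"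
          and eq: "\<And>y. y \<in> F0 \<Longrightarrow> (inv\<^bsub>Aut M\<^esub> g') y = h ((inv\<^bsub>Aut M\<^esub> g) y)"
          unfolding c_def by (auto simp: tg)
        \<comment> \<open>It fixes \<open>F0\<close> pointwise, yet carries
          \<open>\<phi> g' x0\<close> in \<open>U\<close> to \<open>\<phi> g x\<close> in
          \<open>V\<close>, against \<open>stab\<close>.\<close>
        define s where "s = g \<otimes>\<^bsub>Aut M\<^esub> (inv\<^bsub>Aut M\<^esub> h \<otimes>\<^bsub>Aut M\<^esub> inv\<^bsub>Aut M\<^esub> g')"
        have s: "s \<in> ?G" unfolding s_def using g h g'(1) by simp
        have "s y = y" if y: "y \<in> F0" for y
        proof -
          have yM: "y \<in> carrier M" using y F0(1) by blast
          then have "s y = g ((inv\<^bsub>Aut M\<^esub> h) ((inv\<^bsub>Aut M\<^esub> g') y))"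
            unfolding s_def using g h g'(1) by (simp add: Aut_mult Aut_closed)
          also have "\<dots> = g ((inv\<^bsub>Aut M\<^esub> h) (h ((inv\<^bsub>Aut M\<^esub> g) y)))" using eq[OF y] by simp
          also have "\<dots> = g ((inv\<^bsub>Aut M\<^esub> g) y)"
            using Aut_inv_apply(2)[OF h, of "(inv\<^bsub>Aut M\<^esub> g) y"] Aut_closed[of "inv\<^bsub>Aut M\<^esub> g" M y] g yM by simp
          also have "\<dots> = y" using Aut_inv_apply(1)[OF g yM] .
          finally show ?thesis .
        qed
        then have fix_s: "\<forall>y\<in>F t. s y = y" using t by (auto simp: F0_def)
        have "\<phi> s (\<phi> g' x0) = \<phi> (s \<otimes>\<^bsub>Aut M\<^esub> g') x0"
          using composition_rule[OF x0 s g'(1)] by simp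
        also have "s \<otimes>\<^bsub>Aut M\<^esub> g' = g \<otimes>\<^bsub>Aut M\<^esub> inv\<^bsub>Aut M\<^esub> h"
          unfolding s_def using g h g'(1) by (simp add: m_assoc)
        also have "\<phi> (g \<otimes>\<^bsub>Aut M\<^esub> inv\<^bsub>Aut M\<^esub> h) x0 = \<phi> g x"
          unfolding x_def using composition_rule[OF x0 g, of "inv\<^bsub>Aut M\<^esub> h"] h by simp
        finally have "\<phi> s (\<phi> g' x0) \<in> V" using xUV by simp
        then show False
          using F(3)[OF _ s fix_s im[OF g'(1) x0]] g'(2) t T0(1) by (auto simp: tg)
      qed
      then show ?thesis unfolding C_def using x by (simp add: tg)
    qed
    then show ?thesis by blast
  qed
  have "\<Inter>\<F> \<noteq> {}" if "finite \<F>" "\<F> \<subseteq> C ` \<T>" for \<F>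
    using fip finite_subset_image[OF that] by metis
  then have "\<Inter>(C ` \<T>) \<noteq> {}"
    using X(2)[unfolded compact_space_fip, rule_format, of "C ` \<T>"] closed by blast
  then obtain x where x: "\<And>t. t \<in> \<T> \<Longrightarrow> x \<in> C t" by blast
  \<comment> \<open>The set \<open>C\<close> of this triple is the whole space, so it places
    \<open>x\<close> there.\<close>
  have "(\<one>\<^bsub>Aut M\<^esub>, {}, {}) \<in> \<T>"
    unfolding \<T>_def by (auto intro!: exI[of _ "{}"])
  from x[OF this] have xX: "x \<in> topspace X" by (simp add: C_def)
  have reg: "regular_space X" using compact_Hausdorff_imp_regular_space X(2,3) by blast
  have "\<phi> g x = x" if g: "g \<in> ?G" for g
  proof (rule ccontr)
    assume "\<phi> g x \<noteq> x"
    then obtain U0 V0 where UV0: "openin X U0" "openin X V0" "x \<in> U0" "\<phi> g x \<in> V0" "disjnt U0 V0"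
      using X(3) im[OF g xX] xX unfolding Hausdorff_space_def by metis
    \<comment> \<open>Regularity shrinks the separating open sets to ones with disjoint closures,
      which are the closed sets demanded in \<open>\<T>\<close>.\<close>
    have shrink: "\<exists>U. openin X U \<and> y \<in> U \<and> X closure_of U \<subseteq> U'" if "openin X U'" "y \<in> U'" for y U'
    proof -
      have "closedin X (topspace X - U')" "y \<in> topspace X - (topspace X - U')"
        using that openin_subset by (auto simp: closedin_diff)
      then obtain U where "openin X U" "y \<in> U" "disjnt (topspace X - U') (X closure_of U)"
        using reg unfolding regular_space by blast
      then show ?thesis using closure_of_subset_topspace[of X U] by (auto simp: disjnt_iff)
    qed
    obtain U where U: "openin X U" "x \<in> U" "X closure_of U \<subseteq> U0" using shrink UV0(1,3) by blast
    obtain V where V: "openin X V" "\<phi> g x \<in> V" "X closure_of V \<subseteq> V0" using shrink UV0(2,4) by blast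
    have "disjnt (X closure_of U) (X closure_of V)"
      using U(3) V(3) UV0(5) by (meson disjnt_subset1 disjnt_subset2)
    moreover have "U \<subseteq> X closure_of U" "V \<subseteq> X closure_of V"
      using U(1) V(1) by (simp_all add: closure_of_subset openin_subset)
    ultimately have "(g, U, V) \<in> \<T>"
      unfolding \<T>_def using g U(1) V(1) closedin_closure_of by blast
    from x[OF this] U(2) V(2) show False by (simp add: C_def)
  qed
  then show ?thesis using xX by blast
qed

theorem corollary6p1p3:
  fixes k :: nat and M :: "(polysym, 'a) rstruct"
  assumes "k > 0"
    and "fraisse_limit polysym_arity (KP k) M"
  shows "extremely_amenable TYPE('x) (Aut M) (pointwise_topology M)"
proof -
  interpret polyhedral_limit k M by unfold_locales (rule assms)+
  have "Ramsey_orbits M"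
    unfolding Ramsey_orbits_def
  proof (intro allI impI)
    fix F E and c :: "('a \<Rightarrow> 'a) \<Rightarrow> nat" and r
    assume "F \<subseteq> carrier M" "finite F" "E \<subseteq> carrier (Aut M)" "finite E" and c: "\<forall>e. c e < r"
    then show "\<exists>h\<in>carrier (Aut M). \<forall>g\<in>E. \<forall>g'\<in>E. c (\<lambda>x\<in>F. h (g x)) = c (\<lambda>x\<in>F. h (g' x))"
      by (intro Aut_Ramsey[OF _ _ _ _ c[rule_format]])
  qed
  then show ?thesis
    unfolding extremely_amenable_def
    by (intro conjI topological_group_Aut allI impI; elim conjE; rule fixed_point)
qed

end
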